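(* For any integer $d\ge2$ there exists a representation $\rho:\mathsf{SL}_d(\mathbb{R})\ast\mathsf{SL}_d(\mathbb{R})\to\mathsf{GL}_m(\mathbb{R})$, where $m=\frac{d^2(d+1)^2}{4}+1$, with the following property. If $\Gamma_1,\Gamma_2<\mathsf{SL}_d(\mathbb{R})$ are discrete finitely generated subgroups, then there exist finite-index subgroups $H_1<\Gamma_1$ and $H_2<\Gamma_2$ such that the restriction of $\rho$ to $H_1\ast H_2$ (with $H_1$ in the first factor and $H_2$ in the second) is faithful with discrete image. Moreover, for any $\varepsilon\in(0,1)$, the finite-index subgroups $H_1,H_2$ can be chosen so that, in addition, for every reduced word $\gamma_1\cdots\gamma_n\in H_1\ast H_2$, \[\frac{\sigma_1}{\sigma_m}\big(\rho(\gamma_1\cdots\gamma_n)\big)\ge\prod_{i=1}^n\Big(\frac{\sigma_1}{\sigma_d}(\gamma_i)\Big)^{2-\varepsilon}.\]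
   Context: $\sigma_1(g)\ge\cdots\ge\sigma_k(g)$ denote the singular values of $g\in\mathsf{GL}_k(\mathbb{R})$, and $\frac{\sigma_i}{\sigma_j}(g)=\sigma_i(g)/\sigma_j(g)$. A reduced word in $H_1\ast H_2$ is a product $\gamma_1\cdots\gamma_n$ of nontrivial elements of $H_1\cup H_2$ with consecutive factors in different factors. *)

theory Defs
  imports "Jordan_Normal_Form.Char_Poly" "HOL-Algebra.Coset" "HOL-Algebra.Generated_Groups"
    "HOL-Library.Multiset"
begin

definition SL :: "nat \<Rightarrow> real mat monoid" where
  "SL d = \<lparr>carrier = {A \<in> carrier_mat d d. det A = 1}, mult = (*), one = 1\<^sub>m d\<rparr>"

definition GL :: "nat \<Rightarrow> real mat monoid" where
  "GL m = \<lparr>carrier = {A \<in> carrier_mat m m. det A \<noteq> 0}, mult = (*), one = 1\<^sub>m m\<rparr>"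

definition sing_vals :: "real mat \<Rightarrow> real list" where
  "sing_vals A = map sqrt (rev (sorted_list_of_multiset (proots (char_poly (transpose_mat A * A)))))"

definition sigma :: "nat \<Rightarrow> real mat \<Rightarrow> real" where
  "sigma i A = sing_vals A ! (i - 1)"

definition sigma_ratio :: "nat \<Rightarrow> nat \<Rightarrow> real mat \<Rightarrow> real" where
  "sigma_ratio i j A = sigma i A / sigma j A"

definition mat_discrete :: "nat \<Rightarrow> real mat set \<Rightarrow> bool" where
  "mat_discrete n S \<longleftrightarrow> (\<forall>x\<in>S. \<exists>e>0. \<forall>y\<in>S.
     (\<forall>i<n. \<forall>j<n. \<bar>y $$ (i,j) - x $$ (i,j)\<bar> < e) \<longrightarrow> y = x)"

definition discrete_fg_subgroup :: "nat \<Rightarrow> real mat set \<Rightarrow> bool" where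
  "discrete_fg_subgroup d \<Gamma> \<longleftrightarrow> subgroup \<Gamma> (SL d) \<and> mat_discrete d \<Gamma> \<and>
     (\<exists>S. finite S \<and> S \<subseteq> carrier (SL d) \<and> generate (SL d) S = \<Gamma>)"

definition finite_index_sub :: "nat \<Rightarrow> real mat set \<Rightarrow> real mat set \<Rightarrow> bool" where
  "finite_index_sub d H \<Gamma> \<longleftrightarrow> subgroup H (SL d) \<and> H \<subseteq> \<Gamma> \<and>
     finite {H #>\<^bsub>SL d\<^esub> g | g. g \<in> \<Gamma>}"

text \<open>Elements of the free product H1 * H2 (two copies of SL_d(R)) are represented by their
  normal forms: reduced words.  A letter (False, g) lies in the first factor, (True, g) in the second.\<close>
definition reduced_word :: "nat \<Rightarrow> real mat set \<Rightarrow> real mat set \<Rightarrow> (bool \<times> real mat) list \<Rightarrow> bool" where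
  "reduced_word d H1 H2 ws \<longleftrightarrow>
     (\<forall>k<length ws. snd (ws ! k) \<in> (if fst (ws ! k) then H2 else H1) \<and> snd (ws ! k) \<noteq> 1\<^sub>m d) \<and>
     (\<forall>k. Suc k < length ws \<longrightarrow> fst (ws ! k) \<noteq> fst (ws ! Suc k))"

text \<open>The representation of SL_d * SL_d determined (universal property) by its restrictions
  rho1, rho2 to the two factors, evaluated on a word.\<close>
definition fp_eval :: "nat \<Rightarrow> (real mat \<Rightarrow> real mat) \<Rightarrow> (real mat \<Rightarrow> real mat) \<Rightarrow> (bool \<times> real mat) list \<Rightarrow> real mat" where
  "fp_eval m rho1 rho2 ws = foldr (\<lambda>(b, g) acc. (if b then rho2 g else rho1 g) * acc) ws (1\<^sub>m m)"

definition faithful_discrete :: "nat \<Rightarrow> nat \<Rightarrow> (real mat \<Rightarrow> real mat) \<Rightarrow> (real mat \<Rightarrow> real mat) \<Rightarrow> real mat set \<Rightarrow> real mat set \<Rightarrow> bool" where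
  "faithful_discrete d m rho1 rho2 H1 H2 \<longleftrightarrow>
     inj_on (fp_eval m rho1 rho2) {ws. reduced_word d H1 H2 ws} \<and>
     mat_discrete m (fp_eval m rho1 rho2 ` {ws. reduced_word d H1 H2 ws})"

end

(*
Let g in SL_d act on d x d matrices by X |-> g X g^T, extended trivially to R^m; this preserves the
cone of positive semidefinite X, and g X g^T has trace at least c |g|^2 whenever X >= c I.
The second factor acts by the conjugate of this action under a reflection of R^m that sends each
vector (X, t) with X positive semidefinite and |t| <= tr X / 2 to one whose matrix part is bounded
below by (tr X / 2) times the identity. If all nontrivial letters have large norm, each letter
therefore maps this cone back into itself (ping-pong) and multiplies the trace by at least |g|^2 / 2.
This bounds both the image of a word and that of its inverse from below by the product of the |g_i|^2,
respectively |g_i^-1|^2, up to a constant factor per letter absorbed by the exponent epsilon; it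
also keeps the image of a nontrivial word away from the identity.

Only finitely many elements of a discrete group have norm below a given bound, and Malcev's argument
provides a congruence subgroup of finite index avoiding them: the matrix entries of a finitely
generated group lie in a finitely generated integral domain, in which every nonzero element is
invertible modulo some proper ideal with finite quotient.
*)
theory Submission
  imports Defs "Jordan_Normal_Form.Schur_Decomposition"
begin

section \<open>Residual finiteness of finitely generated domains\<close>

text \<open>A large \<open>g\<close> need not increase the trace of \<open>g X g^T\<close> when
  \<open>X\<close> lies on the boundary of the cone, so large norms alone give no growth. The
  reflection supplies what is missing: it adds \<open>q(X, t)\<close> times the identity to
  \<open>X\<close>, where \<open>q(X, t) = tr X + t\<close>. A reflection of the form
  \<open>v + q(v) p\<close> needs \<open>q(p) = -2\<close>, which is impossible inside the matrix
  space alone if \<open>q\<close> is to be positive on the cone and \<open>p\<close> is to be the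
  identity matrix. One extra coordinate resolves the conflict, with
  \<open>p = (I, -(d + 2))\<close>. The price is a last coordinate that may exceed the trace after a
  reflection; \<open>g\<close> leaves it fixed while the trace grows, which is why the squared norms
  of the letters must exceed a multiple of \<open>d + 2\<close>. The exponent 2 reflects that the
  action is quadratic in \<open>g\<close>: the ratio of the extreme singular values agrees, up to a
  bounded factor, with the product of the Frobenius norms of the operator and of its inverse, and
  for the image of a word each of these is controlled by squares of norms of letters.\<close>

definition unital_subring :: "'a::comm_ring_1 set \<Rightarrow> bool" where
  "unital_subring A \<longleftrightarrow> 1 \<in> A \<and> (\<forall>x\<in>A. \<forall>y\<in>A. x - y \<in> A \<and> x * y \<in> A)"

definition ideal_in :: "'a::comm_ring_1 set \<Rightarrow> 'a set \<Rightarrow> bool" where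
  "ideal_in A I \<longleftrightarrow> I \<subseteq> A \<and> 0 \<in> I \<and> (\<forall>x\<in>I. \<forall>y\<in>I. x + y \<in> I) \<and> (\<forall>a\<in>A. \<forall>x\<in>I. a * x \<in> I)"

definition finite_quotient :: "'a::comm_ring_1 set \<Rightarrow> 'a set \<Rightarrow> bool" where
  "finite_quotient A I \<longleftrightarrow> (\<exists>R. finite R \<and> R \<subseteq> A \<and> (\<forall>a\<in>A. \<exists>r\<in>R. a - r \<in> I))"

text \<open>Asking for \<open>a\<close> to be a unit modulo \<open>I\<close>, rather than just nonzero, is what survives adjoining
  an algebraic element, where the leading coefficient of its equation must become invertible.\<close>
definition residually_finite :: "'a::comm_ring_1 set \<Rightarrow> bool" where
  "residually_finite A \<longleftrightarrow> (\<forall>a\<in>A. a \<noteq> 0 \<longrightarrow>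
     (\<exists>I. ideal_in A I \<and> 1 \<notin> I \<and> finite_quotient A I \<and> (\<exists>a'\<in>A. a * a' - 1 \<in> I)))"

definition polys_over :: "'a::comm_ring_1 set \<Rightarrow> 'a poly set" where
  "polys_over A = {p. \<forall>i. coeff p i \<in> A}"

lemma unital_subringD:
  assumes "unital_subring A"
  shows "1 \<in> A" "0 \<in> A" "x \<in> A \<Longrightarrow> - x \<in> A" "x \<in> A \<Longrightarrow> y \<in> A \<Longrightarrow> x - y \<in> A"
    "x \<in> A \<Longrightarrow> y \<in> A \<Longrightarrow> x + y \<in> A" "x \<in> A \<Longrightarrow> y \<in> A \<Longrightarrow> x * y \<in> A"
proof -
  have *: "1 \<in> A" "\<And>x y. x \<in> A \<Longrightarrow> y \<in> A \<Longrightarrow> x - y \<in> A" "\<And>x y. x \<in> A \<Longrightarrow> y \<in> A \<Longrightarrow> x * y \<in> A"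
    using assms by (auto simp: unital_subring_def)
  have 0: "0 \<in> A" using *(2)[OF *(1) *(1)] by simp
  have m: "- x \<in> A" if "x \<in> A" for x using *(2)[OF 0 that] by simp
  show "1 \<in> A" "0 \<in> A" "x \<in> A \<Longrightarrow> - x \<in> A" "x \<in> A \<Longrightarrow> y \<in> A \<Longrightarrow> x - y \<in> A"
    "x \<in> A \<Longrightarrow> y \<in> A \<Longrightarrow> x * y \<in> A"
    using * 0 m by auto
  show "x + y \<in> A" if "x \<in> A" "y \<in> A" using *(2)[OF that(1) m[OF that(2)]] by simp
qed

lemma unital_subring_sum:
  assumes "unital_subring A" "\<And>i. i \<in> S \<Longrightarrow> f i \<in> A"
  shows "sum f S \<in> A"
  using assms(2) by (induction S rule: infinite_finite_induct)
    (auto intro: unital_subringD[OF assms(1)])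

lemma unital_subring_prod:
  assumes "unital_subring A" "\<And>i. i \<in> S \<Longrightarrow> f i \<in> A"
  shows "prod f S \<in> A"
  using assms(2) by (induction S rule: infinite_finite_induct)
    (auto intro: unital_subringD[OF assms(1)])

lemma unital_subring_power:
  assumes "unital_subring A" "x \<in> A"
  shows "x ^ k \<in> A"
  by (induction k) (auto intro: unital_subringD[OF assms(1)] assms(2))

lemma ideal_inD:
  assumes "ideal_in A I"
  shows "x \<in> I \<Longrightarrow> x \<in> A" "0 \<in> I" "x \<in> I \<Longrightarrow> y \<in> I \<Longrightarrow> x + y \<in> I"
    "a \<in> A \<Longrightarrow> x \<in> I \<Longrightarrow> a * x \<in> I" "a \<in> A \<Longrightarrow> x \<in> I \<Longrightarrow> x * a \<in> I"
  using assms by (auto simp: ideal_in_def mult.commute)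

lemma ideal_in_diff:
  assumes "unital_subring A" "ideal_in A I"
  shows "x \<in> I \<Longrightarrow> - x \<in> I" "x \<in> I \<Longrightarrow> y \<in> I \<Longrightarrow> x - y \<in> I"
proof -
  have m: "- x \<in> I" if "x \<in> I" for x
    using ideal_inD(4)[OF assms(2), of "-1" x] unital_subringD[OF assms(1)] that by force
  then show "x \<in> I \<Longrightarrow> - x \<in> I" by blast
  show "x \<in> I \<Longrightarrow> y \<in> I \<Longrightarrow> x - y \<in> I"
    using ideal_inD(3)[OF assms(2), of x "- y"] m by simp
qed

lemma ideal_in_sum:
  assumes "ideal_in A I" "\<And>i. i \<in> S \<Longrightarrow> f i \<in> I"
  shows "sum f S \<in> I"
  using assms(2) by (induction S rule: infinite_finite_induct)
    (auto intro: ideal_inD[OF assms(1)])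

lemma polys_over_monom: "0 \<in> A \<Longrightarrow> a \<in> A \<Longrightarrow> monom a k \<in> polys_over A"
  by (auto simp: polys_over_def)

lemma polys_over_const: "0 \<in> A \<Longrightarrow> a \<in> A \<Longrightarrow> [:a:] \<in> polys_over A"
  by (auto simp: polys_over_def coeff_pCons split: nat.splits)

lemma polys_over_smult: "unital_subring A \<Longrightarrow> a \<in> A \<Longrightarrow> p \<in> polys_over A \<Longrightarrow> Polynomial.smult a p \<in> polys_over A"
  by (auto simp: polys_over_def intro: unital_subringD)

lemma unital_subring_polys_over:
  assumes "unital_subring A"
  shows "unital_subring (polys_over A)"
  unfolding unital_subring_def polys_over_def
  by (auto simp: coeff_mult intro!: unital_subring_sum unital_subringD[OF assms] assms)

lemma ideal_in_polys_over:
  assumes "unital_subring A" "ideal_in A I"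
  shows "ideal_in (polys_over A) (polys_over I)"
  unfolding ideal_in_def polys_over_def
  by (auto simp: coeff_mult intro!: ideal_in_sum[OF assms(2)] ideal_inD(2-4)[OF assms(2)]
      intro: ideal_inD(1)[OF assms(2)])

section \<open>Division with remainder and ideals of the polynomial ring\<close>

lemma pseudo_division:
  assumes A: "unital_subring A" and f: "f \<in> polys_over A" "f \<noteq> 0" and h: "h \<in> polys_over A"
  obtains k q s where "q \<in> polys_over A" "s \<in> polys_over A"
    "Polynomial.smult (lead_coeff f ^ k) h = q * f + s" "s = 0 \<or> degree s < degree f"
proof -
  note PA = unital_subringD[OF unital_subring_polys_over[OF A]]
  have "\<exists>k q s. q \<in> polys_over A \<and> s \<in> polys_over A \<and>
    Polynomial.smult (lead_coeff f ^ k) h = q * f + s \<and> (s = 0 \<or> degree s < degree f)"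
    using h
  proof (induction "degree h" arbitrary: h rule: less_induct)
    case less
    show ?case
    proof (cases "h = 0 \<or> degree h < degree f")
      case True
      then show ?thesis
        by (intro exI[of _ 0] exI[of _ 0] exI[of _ h]) (use less.prems PA in auto)
    next
      case False
      define m where "m = monom (lead_coeff h) (degree h - degree f)"
      \<comment> \<open>Scaling \<open>h\<close> by the leading coefficient of \<open>f\<close>
        instead of dividing keeps all coefficients in \<open>A\<close>; each pass costs one such
        factor, and these accumulate to the exponent \<open>k\<close>.\<close>
      define h' where "h' = Polynomial.smult (lead_coeff f) h - m * f"
      have mA: "m \<in> polys_over A"
        unfolding m_def using less.prems unital_subringD(2)[OF A]
        by (auto intro!: polys_over_monom simp: polys_over_def)
      have cA: "lead_coeff f \<in> A" using f by (auto simp: polys_over_def)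
      have h'A: "h' \<in> polys_over A"
        unfolding h'_def by (intro PA polys_over_smult A cA mA f less.prems)
      have le: "degree h' \<le> degree h"
        unfolding h'_def m_def
        by (intro degree_diff_le order.trans[OF degree_mult_le] degree_smult_le)
          (use False degree_monom_le[of "lead_coeff h" "degree h - degree f"] in \<open>auto\<close>)
      have c0: "coeff h' (degree h) = 0"
        using False by (simp add: h'_def m_def coeff_monom_mult)
      have "h' = 0 \<or> degree h' < degree h"
        using le c0 by (metis leading_coeff_0_iff le_neq_implies_less)
      then have "\<exists>k q s. q \<in> polys_over A \<and> s \<in> polys_over A \<and>
        Polynomial.smult (lead_coeff f ^ k) h' = q * f + s \<and> (s = 0 \<or> degree s < degree f)"
      proof
        assume "h' = 0"
        then show ?thesis
          by (intro exI[of _ 0] exI[of _ 0] exI[of _ 0]) (use PA in auto)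
      qed (use less.hyps h'A in blast)
      then obtain k q s where *: "q \<in> polys_over A" "s \<in> polys_over A"
        "Polynomial.smult (lead_coeff f ^ k) h' = q * f + s" "s = 0 \<or> degree s < degree f" by blast
      have "Polynomial.smult (lead_coeff f ^ Suc k) h = (q + Polynomial.smult (lead_coeff f ^ k) m) * f + s"
        using *(3) unfolding h'_def
        by (simp add: algebra_simps smult_diff_right mult.commute)
      moreover have "q + Polynomial.smult (lead_coeff f ^ k) m \<in> polys_over A"
        by (intro PA * polys_over_smult A mA unital_subring_power cA)
      ultimately show ?thesis using * by blast
    qed
  qed
  then show ?thesis using that by blast
qed

text \<open>The preimage in \<open>A[X]\<close> of the ideal that \<open>f\<close> generates in
  \<open>(A/I)[X]\<close>. Once the leading coefficient of \<open>f\<close> has an inverse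
  \<open>c'\<close> modulo \<open>I\<close>, the polynomial \<open>f\<close> behaves there like a
  monic one, and the quotient is free over \<open>A/I\<close> of rank
  \<open>degree f\<close>.\<close>

definition ext_ideal :: "'a::comm_ring_1 set \<Rightarrow> 'a set \<Rightarrow> 'a poly \<Rightarrow> 'a poly set" where
  "ext_ideal A I f = {i + q * f |i q. i \<in> polys_over I \<and> q \<in> polys_over A}"

lemma ext_idealI: "i \<in> polys_over I \<Longrightarrow> q \<in> polys_over A \<Longrightarrow> p = i + q * f \<Longrightarrow> p \<in> ext_ideal A I f"
  by (auto simp: ext_ideal_def)

context
  fixes A I :: "'a::comm_ring_1 set" and f :: "'a poly" and c' :: 'a
  assumes A: "unital_subring A" and I: "ideal_in A I" and f: "f \<in> polys_over A"
    and c': "c' \<in> A" "lead_coeff f * c' - 1 \<in> I"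
begin

lemma ideal_in_ext_ideal: "ideal_in (polys_over A) (ext_ideal A I f)"
proof -
  note PA = unital_subringD[OF unital_subring_polys_over[OF A]]
  note PI = ideal_inD[OF ideal_in_polys_over[OF A I]]
  show ?thesis
    unfolding ideal_in_def
  proof (intro conjI ballI)
    show "ext_ideal A I f \<subseteq> polys_over A"
      using PI(1) PA f by (auto simp: ext_ideal_def)
    show "0 \<in> ext_ideal A I f"
      by (rule ext_idealI[of 0 _ 0]) (use PA PI in auto)
  next
    fix x y assume "x \<in> ext_ideal A I f" "y \<in> ext_ideal A I f"
    then obtain i q j r where *: "x = i + q * f" "y = j + r * f" "i \<in> polys_over I" "j \<in> polys_over I"
      "q \<in> polys_over A" "r \<in> polys_over A" by (auto simp: ext_ideal_def)
    show "x + y \<in> ext_ideal A I f"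
      by (rule ext_idealI[of "i + j" _ "q + r"]) (use * PA PI in \<open>auto simp: algebra_simps\<close>)
  next
    fix a x assume "a \<in> polys_over A" "x \<in> ext_ideal A I f"
    then obtain i q where *: "x = i + q * f" "i \<in> polys_over I" "q \<in> polys_over A" "a \<in> polys_over A"
      by (auto simp: ext_ideal_def)
    show "a * x \<in> ext_ideal A I f"
      by (rule ext_idealI[of "a * i" _ "a * q"]) (use * PA PI in \<open>auto simp: algebra_simps\<close>)
  qed
qed

lemma ext_ideal_reduce:
  assumes "p \<in> polys_over A" "degree f > 0"
  shows "\<exists>p'\<in>polys_over A. degree p' < degree f \<and> p - p' \<in> ext_ideal A I f"
  using assms(1)
proof (induction "degree p" arbitrary: p rule: less_induct)
  case less
  note PA = unital_subringD[OF unital_subring_polys_over[OF A]]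
  note PI = ideal_inD[OF ideal_in_polys_over[OF A I]]
  note J = ideal_inD[OF ideal_in_ext_ideal]
  show ?case
  proof (cases "degree p < degree f")
    case True
    then show ?thesis using less.prems J(2) by (intro bexI[of _ p]) auto
  next
    case False
    define c where "c = lead_coeff p"
    have cA: "c \<in> A" using less.prems by (auto simp: c_def polys_over_def)
    \<comment> \<open>The top coefficient splits as
      \<open>c = c * c' * lead_coeff f + c * (1 - lead_coeff f * c')\<close>. The multiple
      \<open>m * f\<close> removes the first summand; the second lies in \<open>I\<close>, so
      \<open>e\<close> may be subtracted as well.\<close>
    define m where "m = monom (c * c') (degree p - degree f)"
    define e where "e = monom (c * (1 - lead_coeff f * c')) (degree p)"
    have "c * (1 - lead_coeff f * c') \<in> I"
      using ideal_in_diff(1)[OF A I c'(2)] by (intro ideal_inD(4)[OF I] cA) simp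
    then have e: "e \<in> polys_over I" unfolding e_def
      by (intro polys_over_monom ideal_inD(2)[OF I])
    have m: "m \<in> polys_over A" unfolding m_def
      by (intro polys_over_monom unital_subringD[OF A] cA c')
    define h where "h = p - (e + m * f)"
    have eJ: "e + m * f \<in> ext_ideal A I f" using e m by (intro ext_idealI) auto
    have hA: "h \<in> polys_over A" unfolding h_def by (intro PA less.prems J(1)[OF eJ])
    have le: "degree h \<le> degree p"
      unfolding h_def e_def m_def
      by (intro degree_diff_le degree_add_le order.trans[OF degree_mult_le] degree_monom_le)
        (use False degree_monom_le[of "c * c'" "degree p - degree f"] in auto)
    have "coeff (m * f) (degree p) = c * c' * lead_coeff f"
      using False by (simp add: m_def coeff_monom_mult)
    then have c0: "coeff h (degree p) = 0"
      by (simp add: h_def e_def c_def algebra_simps)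
    have lt: "degree h < degree p"
    proof (rule ccontr)
      assume "\<not> degree h < degree p"
      then have "degree h = degree p" using le by simp
      with c0 have "h = 0" by (metis leading_coeff_0_iff)
      with \<open>degree h = degree p\<close> False assms(2) show False by simp
    qed
    from less.hyps[OF lt hA] obtain p' where p': "p' \<in> polys_over A" "degree p' < degree f"
      "h - p' \<in> ext_ideal A I f" by blast
    have eq: "p - p' = (h - p') + (e + m * f)" by (simp add: h_def)
    have "p - p' \<in> ext_ideal A I f" unfolding eq by (rule J(3)[OF p'(3) eJ])
    with p' show ?thesis by blast
  qed
qed

text \<open>Every class has a representative of degree below \<open>degree f\<close>, and its
  coefficients matter only modulo \<open>I\<close>; so coefficient lists of length
  \<open>degree f\<close> over representatives of \<open>A/I\<close> suffice.\<close>

lemma finite_quotient_ext_ideal: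
  assumes "finite_quotient A I" "degree f > 0"
  shows "finite_quotient (polys_over A) (ext_ideal A I f)"
proof -
  note J = ideal_inD[OF ideal_in_ext_ideal]
  obtain R where R: "finite R" "R \<subseteq> A" "\<And>a. a \<in> A \<Longrightarrow> \<exists>r\<in>R. a - r \<in> I"
    using assms(1) unfolding finite_quotient_def by blast
  define P where "P = (\<lambda>xs. Poly xs) ` {xs. set xs \<subseteq> R \<and> length xs = degree f}"
  have "finite P" unfolding P_def by (intro finite_imageI finite_lists_length_eq R)
  moreover have "P \<subseteq> polys_over A"
    using R(2) unital_subringD(2)[OF A]
    by (auto simp: P_def polys_over_def nth_default_def) (metis nth_mem subsetD)
  moreover have "\<exists>r\<in>P. p - r \<in> ext_ideal A I f" if pA: "p \<in> polys_over A" for p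
  proof -
    obtain p' where p': "p' \<in> polys_over A" "degree p' < degree f" "p - p' \<in> ext_ideal A I f"
      using ext_ideal_reduce[OF pA assms(2)] by blast
    define \<phi> where "\<phi> a = (SOME r. r \<in> R \<and> a - r \<in> I)" for a
    have \<phi>: "\<phi> a \<in> R" "a - \<phi> a \<in> I" if "a \<in> A" for a
      using someI_ex[of "\<lambda>r. r \<in> R \<and> a - r \<in> I"] R(3)[OF that] by (auto simp: \<phi>_def)
    define r where "r = Poly (map (\<lambda>i. \<phi> (coeff p' i)) [0..<degree f])"
    have "r \<in> P" unfolding r_def P_def using p'(1) \<phi>(1) by (intro imageI) (auto simp: polys_over_def)
    have "coeff (p' - r) i \<in> I" for i
      using p' \<phi>(2)[of "coeff p' i"] ideal_inD(2)[OF I] coeff_eq_0[of p' i]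
      by (cases "i < degree f") (auto simp: r_def polys_over_def nth_default_def)
    then have "p' - r \<in> ext_ideal A I f"
      using unital_subringD(2)[OF unital_subring_polys_over[OF A]]
      by (intro ext_idealI[of "p' - r" _ 0]) (auto simp: polys_over_def)
    from J(3)[OF p'(3) this] \<open>r \<in> P\<close> show ?thesis by (intro bexI[of _ r]) auto
  qed
  ultimately show ?thesis unfolding finite_quotient_def by blast
qed

text \<open>Modulo \<open>I\<close> the equation \<open>1 = q * f\<close> is impossible by degrees:
  \<open>A/I\<close> may have zero divisors, but the leading coefficient of \<open>f\<close> is a
  unit there, so a nonzero \<open>q\<close> would give a product of positive degree.\<close>

lemma one_notin_ext_ideal:
  assumes "1 \<notin> I" "degree f > 0"
  shows "1 \<notin> ext_ideal A I f"
proof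
  assume "1 \<in> ext_ideal A I f"
  then obtain i q where iq: "i \<in> polys_over I" "q \<in> polys_over A" "1 = i + q * f"
    by (auto simp: ext_ideal_def)
  have fA: "coeff f k \<in> A" and qA: "coeff q k \<in> A" and iI: "coeff i k \<in> I" for k
    using iq f by (auto simp: polys_over_def)
  have fq: "f * q = 1 - i" using iq(3) by (simp add: algebra_simps)
  have "q \<in> polys_over I"
  proof (rule ccontr)
    \<comment> \<open>The maximum of \<open>N\<close> is the degree of \<open>q\<close> modulo
      \<open>I\<close>. In degree \<open>n + j\<close> only the product of the two leading
      coefficients survives modulo \<open>I\<close>.\<close>
    define N where "N = {j. coeff q j \<notin> I}"
    assume "q \<notin> polys_over I"
    then have "N \<noteq> {}" by (auto simp: N_def polys_over_def)
    moreover have "N \<subseteq> {..degree q}"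
      using coeff_eq_0[of q] ideal_inD(2)[OF I] by (force simp: N_def not_less[symmetric])
    then have "finite N" by (rule finite_subset) simp
    ultimately have j: "Max N \<in> N" "\<And>l. l > Max N \<Longrightarrow> coeff q l \<in> I"
      using Max_in Max_ge[of N] leD by (auto simp: N_def)
    define j where "j = Max N"
    define n where "n = degree f"
    have "coeff (f * q) (n + j) = (\<Sum>l\<le>n + j. coeff f l * coeff q (n + j - l))"
      by (simp add: coeff_mult)
    also have "\<dots> = coeff f n * coeff q j + (\<Sum>l\<in>{..n + j} - {n}. coeff f l * coeff q (n + j - l))"
      by (subst sum.remove[of _ n]) auto
    finally have eq: "coeff f n * coeff q j = coeff (f * q) (n + j) -
      (\<Sum>l\<in>{..n + j} - {n}. coeff f l * coeff q (n + j - l))" by simp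
    have "coeff f l * coeff q (n + j - l) \<in> I" if "l \<in> {..n + j} - {n}" for l
    proof (cases "l < n")
      case True
      then show ?thesis using that j(2)[of "n + j - l"] by (intro ideal_inD(4)[OF I] fA) (auto simp: j_def)
    next
      case False
      then show ?thesis using that coeff_eq_0[of f l] ideal_inD(2)[OF I] by (auto simp: n_def)
    qed
    then have "(\<Sum>l\<in>{..n + j} - {n}. coeff f l * coeff q (n + j - l)) \<in> I"
      by (rule ideal_in_sum[OF I])
    moreover have "coeff (f * q) (n + j) \<in> I"
      using assms(2) ideal_in_diff(1)[OF A I iI] by (simp add: fq n_def coeff_1)
    ultimately have "coeff f n * coeff q j \<in> I" unfolding eq by (intro ideal_in_diff(2)[OF A I])
    then have "c' * (coeff f n * coeff q j) \<in> I" by (intro ideal_inD(4)[OF I c'(1)])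
    moreover have "(lead_coeff f * c' - 1) * coeff q j \<in> I" by (intro ideal_inD(5)[OF I qA c'(2)])
    ultimately have "c' * (coeff f n * coeff q j) - (lead_coeff f * c' - 1) * coeff q j \<in> I"
      by (intro ideal_in_diff(2)[OF A I])
    then have "coeff q j \<in> I" by (simp add: n_def algebra_simps)
    with j(1) show False by (simp add: N_def j_def)
  qed
  then have "i + q * f \<in> polys_over I"
    using ideal_inD(3,5)[OF ideal_in_polys_over[OF A I]] iq(1) f by blast
  then have "1 \<in> polys_over I" by (simp flip: iq(3))
  then have "coeff 1 0 \<in> I" by (simp only: polys_over_def) blast
  with assms(1) show False by simp
qed

end

text \<open>Evaluation at \<open>x\<close> maps \<open>A[X]\<close> onto \<open>A[x]\<close>, and an
  ideal containing its kernel keeps its quotient. The assumption \<open>ker\<close> prevents the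
  image of \<open>J\<close> from becoming the whole ring.\<close>

lemma eval_ideal:
  assumes A: "unital_subring A" and J: "ideal_in (polys_over A) J" "1 \<notin> J" "finite_quotient (polys_over A) J"
    and ker: "\<And>h. h \<in> polys_over A \<Longrightarrow> poly h x = 0 \<Longrightarrow> h \<in> J"
  defines "ev \<equiv> \<lambda>p. poly p x"
  shows "ideal_in (ev ` polys_over A) (ev ` J)" "1 \<notin> ev ` J" "finite_quotient (ev ` polys_over A) (ev ` J)"
proof -
  note PA = unital_subringD[OF unital_subring_polys_over[OF A]]
  note J' = ideal_inD[OF J(1)]
  show "ideal_in (ev ` polys_over A) (ev ` J)"
    unfolding ideal_in_def
  proof (intro conjI ballI)
    show "ev ` J \<subseteq> ev ` polys_over A" using J' by auto
    show "0 \<in> ev ` J" using J'(2) by (force simp: ev_def)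
  next
    fix a b assume "a \<in> ev ` J" "b \<in> ev ` J"
    then show "a + b \<in> ev ` J" using J'(3) by (auto simp: ev_def simp flip: poly_add)
  next
    fix a b assume "a \<in> ev ` polys_over A" "b \<in> ev ` J"
    then show "a * b \<in> ev ` J" using J'(4) by (auto simp: ev_def simp flip: poly_mult)
  qed
  show "1 \<notin> ev ` J"
  proof
    assume "1 \<in> ev ` J"
    then obtain j where j: "j \<in> J" "poly j x = 1" by (auto simp: ev_def)
    then have "1 - j \<in> J" using PA(1,4) J'(1) by (intro ker) auto
    from J'(3)[OF this j(1)] J(2) show False by simp
  qed
  obtain R where R: "finite R" "R \<subseteq> polys_over A" "\<And>a. a \<in> polys_over A \<Longrightarrow> \<exists>r\<in>R. a - r \<in> J"
    using J(3) unfolding finite_quotient_def by blast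
  show "finite_quotient (ev ` polys_over A) (ev ` J)"
    unfolding finite_quotient_def
  proof (intro exI[of _ "ev ` R"] conjI ballI)
    fix a assume "a \<in> ev ` polys_over A"
    then obtain p where p: "p \<in> polys_over A" "a = poly p x" by (auto simp: ev_def)
    obtain r where "r \<in> R" "p - r \<in> J" using R(3)[OF p(1)] by blast
    then show "\<exists>r\<in>ev ` R. a - r \<in> ev ` J"
      by (auto simp: ev_def p simp flip: poly_diff)
  qed (use R in auto)
qed

text \<open>Euclid's algorithm over the fraction field, run without denominators: an algebraic element
  is a unit up to elements of the base ring.\<close>
lemma algebraic_multiple_in_base:
  fixes A :: "'a::field set"
  assumes A: "unital_subring A" and p: "p \<in> polys_over A" "p \<noteq> 0" "poly p x = 0"
    and min: "\<And>q. q \<in> polys_over A \<Longrightarrow> q \<noteq> 0 \<Longrightarrow> poly q x = 0 \<Longrightarrow> degree p \<le> degree q"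
    and g: "g \<in> polys_over A" "poly g x \<noteq> 0"
  obtains r u where "r \<in> A" "r \<noteq> 0" "u \<in> polys_over A" "r = poly u x * poly g x"
proof -
  note PA = unital_subringD[OF unital_subring_polys_over[OF A]]
  \<comment> \<open>\<open>D\<close> describes the nonzero elements of the principal ideal of
    \<open>A[x]\<close> generated by \<open>poly g x\<close>, through polynomials representing them.
    A representative of least degree will turn out to be constant, that is, an element of
    \<open>A\<close>.\<close>
  define D where "D = (\<lambda>s. s \<in> polys_over A \<and> poly s x \<noteq> 0 \<and>
    (\<exists>u\<in>polys_over A. poly s x = poly u x * poly g x))"
  have "D g" using g PA(1) by (auto simp: D_def intro!: bexI[of _ 1])
  then obtain s where s: "D s" "\<And>t. D t \<Longrightarrow> degree s \<le> degree t"
    using ex_has_least_nat[of D g degree] by blast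
  obtain u where u: "u \<in> polys_over A" "poly s x = poly u x * poly g x" using s by (auto simp: D_def)
  have sA: "s \<in> polys_over A" "poly s x \<noteq> 0" "s \<noteq> 0" using s(1) by (auto simp: D_def)
  have "degree s < degree p"
  proof -
    obtain k q t where *: "q \<in> polys_over A" "t \<in> polys_over A" "Polynomial.smult (lead_coeff p ^ k) s = q * p + t"
      "t = 0 \<or> degree t < degree p" using pseudo_division[OF A p(1,2) sA(1)] by blast
    have eq: "poly t x = lead_coeff p ^ k * poly s x"
      using arg_cong[OF *(3), of "\<lambda>h. poly h x"] p(3) by simp
    have c: "lead_coeff p ^ k \<in> A" using p(1) by (intro unital_subring_power A) (auto simp: polys_over_def)
    have "D t" unfolding D_def
      using *(2) eq sA p(2) u polys_over_smult[OF A c u(1)]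
      by (auto intro!: bexI[of _ "Polynomial.smult (lead_coeff p ^ k) u"])
    with s(2)[of t] *(4) show ?thesis by (auto simp: D_def)
  qed
  have "degree s = 0"
  proof (rule ccontr)
    assume pos: "degree s \<noteq> 0"
    obtain k q t where *: "q \<in> polys_over A" "t \<in> polys_over A" "Polynomial.smult (lead_coeff s ^ k) p = q * s + t"
      "t = 0 \<or> degree t < degree s" using pseudo_division[OF A sA(1,3) p(1)] by blast
    have eq: "poly t x = - poly q x * poly s x"
      using arg_cong[OF *(3), of "\<lambda>h. poly h x"] p(3) by (simp add: algebra_simps eq_neg_iff_add_eq_0)
    have "poly t x = 0"
    proof (rule ccontr)
      assume "poly t x \<noteq> 0"
      then have "D t" unfolding D_def
        using *(1,2) eq u PA by (auto intro!: bexI[of _ "- q * u"])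
      with s(2)[of t] *(4) show False by (auto simp: D_def)
    qed
    with min[of t] *(2,4) \<open>degree s < degree p\<close> have "t = 0" by force
    \<comment> \<open>Up to a nonzero constant \<open>p\<close> is now \<open>q * s\<close>, and
      \<open>s\<close> does not vanish at \<open>x\<close>, so \<open>q\<close> does; as
      \<open>s\<close> was assumed nonconstant, this contradicts the minimality of
      \<open>degree p\<close>.\<close>
    have "poly q x = 0" using eq \<open>poly t x = 0\<close> sA by simp
    have ne: "q * s \<noteq> 0" using *(3) \<open>t = 0\<close> p(2) sA(3) by auto
    then have "q \<noteq> 0" by auto
    have "degree p = degree q + degree s"
      using arg_cong[OF *(3), of degree] \<open>t = 0\<close> sA(3) \<open>q \<noteq> 0\<close> by (simp add: degree_mult_eq)
    with min[OF *(1) \<open>q \<noteq> 0\<close> \<open>poly q x = 0\<close>] pos show False by simp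
  qed
  then obtain r where r: "s = [:r:]" using degree_eq_zeroE by blast
  show ?thesis
    by (rule that[of r u]) (use r sA u in \<open>auto simp: polys_over_def dest: spec[of _ 0]\<close>)
qed

text \<open>For transcendental \<open>x\<close> evaluation is injective, so \<open>f\<close> can be
  chosen freely to make \<open>g\<close> invertible. For algebraic \<open>x\<close> the ideal must
  contain the kernel, which forces \<open>f\<close> to be a polynomial of least degree vanishing at
  \<open>x\<close>; then \<open>g\<close> is inverted through a multiple of it lying in
  \<open>A\<close>.\<close>

lemma residually_finite_adjoin:
  fixes A :: "'a::field set"
  assumes A: "unital_subring A" and rf: "residually_finite A"
  shows "residually_finite ((\<lambda>p. poly p x) ` polys_over A)"
  unfolding residually_finite_def
proof (intro ballI impI)
  note PA = unital_subringD[OF unital_subring_polys_over[OF A]]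
  let ?ev = "\<lambda>p. poly p x"
  fix b assume "b \<in> ?ev ` polys_over A" and "b \<noteq> 0"
  then obtain g where g: "g \<in> polys_over A" "b = poly g x" "poly g x \<noteq> 0" by auto
  \<comment> \<open>The part common to both cases; \<open>w\<close> is an inverse of
    \<open>g\<close> modulo the ideal generated by \<open>I\<close> and \<open>f\<close>.\<close>
  have goal: "\<exists>I. ideal_in (?ev ` polys_over A) I \<and> 1 \<notin> I \<and> finite_quotient (?ev ` polys_over A) I \<and>
      (\<exists>a'\<in>?ev ` polys_over A. b * a' - 1 \<in> I)"
    if f: "f \<in> polys_over A" "degree f > 0" and I: "ideal_in A I" "1 \<notin> I" "finite_quotient A I"
      and c': "c' \<in> A" "lead_coeff f * c' - 1 \<in> I"
      and ker: "\<And>h. h \<in> polys_over A \<Longrightarrow> poly h x = 0 \<Longrightarrow> h \<in> ext_ideal A I f"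
      and w: "w \<in> polys_over A" "w * g - 1 \<in> ext_ideal A I f" for f I c' w
  proof -
    let ?J = "ext_ideal A I f"
    have "b * poly w x - 1 = ?ev (w * g - 1)" by (simp add: g)
    then have "b * poly w x - 1 \<in> ?ev ` ?J" using w(2) by blast
    then have unit: "\<exists>a'\<in>?ev ` polys_over A. b * a' - 1 \<in> ?ev ` ?J" using w(1) by blast
    note eval = eval_ideal[OF A ideal_in_ext_ideal[OF A I(1) f(1) c'] one_notin_ext_ideal[OF A I(1) f(1) c' I(2) f(2)]
        finite_quotient_ext_ideal[OF A I(1) f(1) c' I(3) f(2)] ker]
    show ?thesis by (intro exI[of _ "?ev ` ?J"] conjI eval unit)
  qed
  show "\<exists>I. ideal_in (?ev ` polys_over A) I \<and> 1 \<notin> I \<and> finite_quotient (?ev ` polys_over A) I \<and>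
      (\<exists>a'\<in>?ev ` polys_over A. b * a' - 1 \<in> I)"
  proof (cases "\<exists>p. p \<in> polys_over A \<and> p \<noteq> 0 \<and> poly p x = 0")
    case False
    have "lead_coeff g \<in> A" "lead_coeff g \<noteq> 0" using g by (auto simp: polys_over_def)
    then obtain I c' where I: "ideal_in A I" "1 \<notin> I" "finite_quotient A I" "c' \<in> A" "lead_coeff g * c' - 1 \<in> I"
      using rf unfolding residually_finite_def by blast
    \<comment> \<open>Modulo \<open>1 + X g\<close> the polynomial \<open>g\<close> is a unit with inverse \<open>- X\<close>.\<close>
    define f where "f = pCons 1 g"
    have f: "f \<in> polys_over A"
      using g unital_subringD[OF A] by (auto simp: f_def polys_over_def coeff_pCons split: nat.splits)
    have "g \<noteq> 0" using g by auto
    then have lc: "lead_coeff f = lead_coeff g" "degree f > 0" by (auto simp: f_def)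
    have X: "- [:0, 1:] \<in> polys_over A"
      using unital_subringD[OF A] by (auto simp: polys_over_def coeff_pCons split: nat.splits)
    have "- [:0, 1:] * g - 1 = 0 + (- 1) * f" by (simp add: f_def one_pCons)
    then have "- [:0, 1:] * g - 1 \<in> ext_ideal A I f"
      by (intro ext_idealI[of 0 _ "- 1"]) (use PA ideal_inD[OF ideal_in_polys_over[OF A I(1)]] in auto)
    with X show ?thesis
      using False I lc f PA(2)
        ideal_inD(2)[OF ideal_in_ext_ideal[OF A I(1) f, of c']]
      by (intro goal[of f I c' "- [:0, 1:]"]) auto
  next
    case True
    obtain p where p: "p \<in> polys_over A" "p \<noteq> 0" "poly p x = 0"
      "\<And>q. q \<in> polys_over A \<Longrightarrow> q \<noteq> 0 \<Longrightarrow> poly q x = 0 \<Longrightarrow> degree p \<le> degree q"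
      using True ex_has_least_nat[of "\<lambda>p. p \<in> polys_over A \<and> p \<noteq> 0 \<and> poly p x = 0" _ degree] by metis
    obtain r u where ru: "r \<in> A" "r \<noteq> 0" "u \<in> polys_over A" "r = poly u x * poly g x"
      using algebraic_multiple_in_base[OF A p g(1,3)] by blast
    have dp: "degree p > 0"
      using p(2,3) by (metis degree_eq_zeroE gr0I poly_const_conv pCons_0_0)
    define c where "c = lead_coeff p"
    have c: "c \<in> A" "c \<noteq> 0" using p by (auto simp: c_def polys_over_def)
    \<comment> \<open>Inverting the single element \<open>c * r\<close> inverts both factors: modulo
      \<open>I\<close> the inverse of \<open>c\<close> is \<open>r * a'\<close>, and that of
      \<open>r\<close> is \<open>c * a'\<close>.\<close>
    have "c * r \<in> A" "c * r \<noteq> 0" using c ru unital_subringD[OF A] by auto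
    then obtain I a' where I: "ideal_in A I" "1 \<notin> I" "finite_quotient A I" "a' \<in> A" "c * r * a' - 1 \<in> I"
      using rf unfolding residually_finite_def by blast
    have ra: "r * a' \<in> A" by (intro unital_subringD[OF A] ru I)
    have ca: "c * a' \<in> A" by (intro unital_subringD[OF A] c I)
    have cI: "c * (r * a') - 1 \<in> I" using I(5) by (simp add: mult.assoc)
    \<comment> \<open>Pseudo-division by \<open>p\<close> leaves no remainder, by minimality of its
      degree, but introduces the factor \<open>c ^ k\<close>; multiplication by
      \<open>(r * a') ^ k\<close> undoes it up to an error in \<open>I\<close>.\<close>
    have ker: "h \<in> ext_ideal A I p" if h: "h \<in> polys_over A" "poly h x = 0" for h
    proof -
      obtain k q t where *: "q \<in> polys_over A" "t \<in> polys_over A" "Polynomial.smult (c ^ k) h = q * p + t"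
        "t = 0 \<or> degree t < degree p" using pseudo_division[OF A p(1,2) h(1)] unfolding c_def by blast
      have "poly t x = 0" using arg_cong[OF *(3), of "\<lambda>h. poly h x"] p(3) h(2) by simp
      then have t: "t = 0" using p(4)[of t] * by fastforce
      have kI: "(c * (r * a')) ^ k - 1 \<in> I" for k
      proof (induction k)
        case (Suc k)
        have "c * (r * a') * ((c * (r * a')) ^ k - 1) + (c * (r * a') - 1) \<in> I"
          by (intro ideal_inD[OF I(1)] cI Suc.IH unital_subringD[OF A] c ra)
        then show ?case by (simp add: algebra_simps)
      qed (use ideal_inD(2)[OF I(1)] in auto)
      let ?e = "(c * (r * a')) ^ k"
      have "h = Polynomial.smult (1 - ?e) h + Polynomial.smult ((r * a') ^ k) (Polynomial.smult (c ^ k) h)"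
        by (simp add: power_mult_distrib mult.commute flip: smult_add_left)
      also have "\<dots> = Polynomial.smult (1 - ?e) h + Polynomial.smult ((r * a') ^ k) q * p" by (simp add: *(3) t)
      finally have eq: "h = Polynomial.smult (1 - ?e) h + Polynomial.smult ((r * a') ^ k) q * p" .
      have "Polynomial.smult (1 - ?e) h \<in> polys_over I"
        using ideal_in_diff(1)[OF A I(1) kI[of k]] h(1)
        by (auto simp: polys_over_def intro!: ideal_inD(5)[OF I(1)])
      moreover have "Polynomial.smult ((r * a') ^ k) q \<in> polys_over A"
        by (intro polys_over_smult A unital_subring_power ra *)
      ultimately show ?thesis using eq by (rule ext_idealI)
    qed
    \<comment> \<open>The product of \<open>u\<close> and \<open>g\<close> takes the value
      \<open>r\<close> at \<open>x\<close>, so \<open>w * g\<close> takes the value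
      \<open>c * r * a'\<close>, which is 1 modulo \<open>I\<close>.\<close>
    define w where "w = Polynomial.smult (c * a') u"
    have w: "w \<in> polys_over A" unfolding w_def by (intro polys_over_smult A ca ru)
    have J: "ideal_in (polys_over A) (ext_ideal A I p)"
      using ideal_in_ext_ideal[OF A I(1) p(1) ra] cI by (simp add: c_def)
    have "poly (w * g - [:c * r * a':]) x = 0"
      by (simp add: w_def ru(4) algebra_simps)
    then have "w * g - [:c * r * a':] \<in> ext_ideal A I p"
      by (intro ker PA w g polys_over_const unital_subringD[OF A] c ru I)
    moreover have "[:c * r * a' - 1:] \<in> ext_ideal A I p"
      by (rule ext_idealI[of "[:c * r * a' - 1:]" _ 0])
        (use I ideal_inD(2)[OF I(1)] PA in \<open>auto intro: polys_over_const\<close>)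
    ultimately have "(w * g - [:c * r * a':]) + [:c * r * a' - 1:] \<in> ext_ideal A I p"
      by (rule ideal_inD(3)[OF J])
    moreover have "[:c * r * a' - 1:] = [:c * r * a':] - 1" by (simp add: one_pCons)
    ultimately have "w * g - 1 \<in> ext_ideal A I p" by simp
    with goal[OF p(1) dp I(1-3) ra _ ker w] cI show ?thesis by (simp add: c_def)
  qed
qed

lemma residually_finite_Ints: "residually_finite (\<int> :: 'a::{comm_ring_1,ring_char_0} set)"
  unfolding residually_finite_def
proof (intro ballI impI)
  fix a :: 'a assume "a \<in> \<int>" "a \<noteq> 0"
  then obtain z where z: "a = of_int z" "z \<noteq> 0" by (auto elim: Ints_cases)
  \<comment> \<open>With this modulus \<open>z\<close> is a unit whose inverse is known:
    \<open>z * (- sgn z) = 1 - N\<close>. Moreover \<open>N > 1\<close> because \<open>z\<close> is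
    nonzero.\<close>
  define N where "N = \<bar>z\<bar> + 1"
  have N: "N > 1" using z by (auto simp: N_def)
  define I :: "'a set" where "I = range (\<lambda>k. of_int (N * k))"
  have mem: "(of_int k :: 'a) \<in> I \<longleftrightarrow> N dvd k" for k
    by (auto simp: I_def image_iff dvd_def simp del: of_int_mult)
  have "ideal_in \<int> I"
    unfolding ideal_in_def
  proof (intro conjI ballI)
    show "I \<subseteq> \<int>" by (auto simp: I_def)
    show "0 \<in> I" using mem[of 0] by simp
  next
    fix x y assume "x \<in> I" "y \<in> I"
    then obtain k l where "x = of_int (N * k)" "y = of_int (N * l)" by (auto simp: I_def)
    then show "x + y \<in> I" using mem[of "N * k + N * l"] by simp
  next
    fix x y :: 'a assume "x \<in> \<int>" "y \<in> I"
    then obtain k l where "x = of_int k" "y = of_int (N * l)" by (auto simp: I_def elim: Ints_cases)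
    then show "x * y \<in> I" using mem[of "k * (N * l)"] by simp
  qed
  moreover have "1 \<notin> I" using mem[of 1] N by simp
  moreover have "finite_quotient \<int> I"
    unfolding finite_quotient_def
  proof (intro exI[of _ "of_int ` {0..<N}"] conjI ballI)
    fix a :: 'a assume "a \<in> \<int>"
    then obtain k where k: "a = of_int k" by (auto elim: Ints_cases)
    have "a - of_int (k mod N) \<in> I"
      using mem[of "k - k mod N"] by (simp add: k)
    then show "\<exists>r\<in>of_int ` {0..<N}. a - r \<in> I" using N by auto
  qed auto
  moreover have "a * of_int (- sgn z) - 1 \<in> I"
  proof -
    have "z * (- sgn z) - 1 = - N" by (simp add: N_def abs_sgn)
    then have "of_int (z * (- sgn z) - 1) \<in> I" unfolding mem by simp
    then show ?thesis by (simp add: z)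
  qed
  ultimately show "\<exists>I. ideal_in \<int> I \<and> 1 \<notin> I \<and> finite_quotient \<int> I \<and> (\<exists>a'\<in>\<int>. a * a' - 1 \<in> I)"
    by (intro exI[of _ I] conjI bexI[of _ "of_int (- sgn z)"]) auto
qed

text \<open>Characteristic zero lets the induction start from the integers; the generators are then
  adjoined one at a time, in any order and whether or not they are algebraic over what came
  before.\<close>

theorem finitely_generated_residually_finite:
  fixes S :: "'a::field_char_0 set"
  assumes "finite S"
  obtains A where "unital_subring A" "S \<subseteq> A" "residually_finite A"
proof -
  from assms have "\<exists>A. unital_subring A \<and> S \<subseteq> A \<and> residually_finite A"
  proof induction
    case empty
    have "unital_subring (\<int> :: 'a set)" by (auto simp: unital_subring_def)
    then show ?case using residually_finite_Ints by blast
  next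
    case (insert x S)
    then obtain A where A: "unital_subring A" "S \<subseteq> A" "residually_finite A" by blast
    let ?B = "(\<lambda>p. poly p x) ` polys_over A"
    note PA = unital_subringD[OF unital_subring_polys_over[OF A(1)]]
    have "unital_subring ?B"
      unfolding unital_subring_def
    proof (intro conjI ballI)
      show "1 \<in> ?B" using PA(1) by (force intro: rev_image_eqI)
      show "a - b \<in> ?B" if "a \<in> ?B" "b \<in> ?B" for a b
        using that PA(4) by (auto simp flip: poly_diff)
      show "a * b \<in> ?B" if "a \<in> ?B" "b \<in> ?B" for a b
        using that PA(6) by (auto simp flip: poly_mult)
    qed
    moreover have "x \<in> ?B"
      using unital_subringD[OF A(1)]
      by (intro image_eqI[of _ _ "[:0, 1:]"]) (auto simp: polys_over_def coeff_pCons split: nat.splits)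
    moreover have "S \<subseteq> ?B"
      using A(2) polys_over_const[OF unital_subringD(2)[OF A(1)]]
      by (intro subsetI image_eqI[of _ _ "[:y:]" for y]) auto
    ultimately show ?case using residually_finite_adjoin[OF A(1,3)] by blast
  qed
  then show ?thesis using that by blast
qed

section \<open>Singular values and the Frobenius norm\<close>

lemma mult_entry:
  "A \<in> carrier_mat nr n \<Longrightarrow> B \<in> carrier_mat n nc \<Longrightarrow> i < nr \<Longrightarrow> j < nc \<Longrightarrow>
    (A * B) $$ (i,j) = (\<Sum>k<n. A $$ (i,k) * B $$ (k,j))"
  by (auto simp: times_mat_def scalar_prod_def atLeast0LessThan)

definition frob2 :: "real mat \<Rightarrow> real" where
  "frob2 A = (\<Sum>i<dim_row A. \<Sum>j<dim_col A. (A $$ (i,j))\<^sup>2)"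

definition mtrace :: "'a::comm_ring_1 mat \<Rightarrow> 'a" where
  "mtrace A = (\<Sum>i<dim_row A. A $$ (i,i))"

lemma frob2_nonneg: "frob2 A \<ge> 0"
  by (simp add: frob2_def sum_nonneg)

lemma frob2_transpose: "frob2 (transpose_mat A) = frob2 A"
  by (simp add: frob2_def) (subst sum.swap, simp)

lemma mtrace_gram:
  assumes "A \<in> carrier_mat nr nc"
  shows "mtrace (transpose_mat A * A) = frob2 A"
proof -
  have "mtrace (transpose_mat A * A) = (\<Sum>i<nc. \<Sum>k<nr. A $$ (k,i) * A $$ (k,i))"
    using assms by (auto simp: mtrace_def mult_entry[of _ nc nr _ nc] simp del: index_mult_mat(1) intro!: sum.cong)
  also have "\<dots> = frob2 A"
    using assms by (subst sum.swap) (simp add: frob2_def power2_eq_square)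
  finally show ?thesis .
qed

lemma mtrace_mult_commute:
  assumes "A \<in> carrier_mat n n" "B \<in> carrier_mat n n"
  shows "mtrace (A * B) = mtrace (B * A)"
proof -
  have "mtrace (A * B) = (\<Sum>i<n. \<Sum>k<n. A $$ (i,k) * B $$ (k,i))"
    using assms by (auto simp: mtrace_def mult_entry[of _ n n _ n] simp del: index_mult_mat(1) intro!: sum.cong)
  also have "\<dots> = (\<Sum>k<n. \<Sum>i<n. B $$ (k,i) * A $$ (i,k))"
    by (subst sum.swap) (simp add: mult.commute)
  also have "\<dots> = mtrace (B * A)"
    using assms by (auto simp: mtrace_def mult_entry[of _ n n _ n] simp del: index_mult_mat(1) intro!: sum.cong)
  finally show ?thesis .
qed

lemma mtrace_eq_sum_eigenvalues:
  fixes A :: "'a::conjugatable_ordered_field mat"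
  assumes A: "A \<in> carrier_mat n n" and cp: "char_poly A = (\<Prod>e\<leftarrow>es. [:- e, 1:])"
  shows "mtrace A = sum_list es"
proof -
  obtain U P Q where "schur_decomposition A es = (U,P,Q)" by (cases "schur_decomposition A es") auto
  from schur_decomposition[OF A cp this]
  have sim: "similar_mat_wit A U P Q" and diag: "diag_mat U = es" by auto
  note w = similar_mat_witD2[OF A sim]
  have "mtrace A = mtrace (P * (U * Q))" using w by (simp add: assoc_mult_mat[of P n n U n Q n])
  also have "\<dots> = mtrace ((U * Q) * P)" using w by (intro mtrace_mult_commute) auto
  also have "(U * Q) * P = U" using w by (simp add: assoc_mult_mat[of U n n Q n P n])
  also have "mtrace U = sum_list es"
    using w unfolding diag[symmetric]
    by (simp add: mtrace_def diag_mat_def interv_sum_list_conv_sum_set_nat atLeast0LessThan)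
  finally show ?thesis .
qed

text \<open>Pairing the eigenvector equation with the conjugate of the eigenvector \<open>v\<close>
  gives \<open>a * |v|^2 = |A v|^2\<close>, because the transpose of a real matrix is its
  adjoint.\<close>

lemma gram_eigenvalue_complex:
  fixes A :: "real mat"
  assumes A: "A \<in> carrier_mat n n"
    and ev: "eigenvalue (map_mat complex_of_real (transpose_mat A * A)) a"
  shows "a \<in> \<real>" "Re a \<ge> 0"
proof -
  let ?c = "map_mat complex_of_real"
  have C: "?c (transpose_mat A * A) = transpose_mat (?c A) * ?c A"
    using A by (subst of_real_hom.mat_hom_mult[of _ n n]) (auto simp: map_mat_transpose)
  define A' where "A' = ?c A"
  have A': "A' \<in> carrier_mat n n" using A by (simp add: A'_def)
  obtain v where v: "v \<in> carrier_vec n" "v \<noteq> 0\<^sub>v n" "(transpose_mat A' * A') *\<^sub>v v = a \<cdot>\<^sub>v v"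
    using ev A A' unfolding eigenvalue_def eigenvector_def C A'_def[symmetric] by auto
  define w where "w = A' *\<^sub>v v"
  have w: "w \<in> carrier_vec n" using A' v by (simp add: w_def)
  have "transpose_mat A' *\<^sub>v w = a \<cdot>\<^sub>v v"
    using v A' by (simp add: w_def assoc_mult_mat_vec[of _ n n _ n])
  then have eq: "(\<Sum>k<n. A' $$ (k,i) * w $ k) = a * v $ i" if "i < n" for i
    using that A' v(1) w by (auto dest!: arg_cong[of _ _ "\<lambda>u. u $ i"] simp: scalar_prod_def atLeast0LessThan)
  have wk: "w $ k = (\<Sum>i<n. A' $$ (k,i) * v $ i)" if "k < n" for k
    using that A' v(1) by (simp add: w_def scalar_prod_def atLeast0LessThan)
  have real: "cnj (A' $$ (k,i)) = A' $$ (k,i)" if "k < n" "i < n" for k i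
    using that A by (simp add: A'_def)
  have "a * (\<Sum>i<n. v $ i * cnj (v $ i)) = (\<Sum>i<n. (\<Sum>k<n. A' $$ (k,i) * w $ k) * cnj (v $ i))"
    by (simp add: eq sum_distrib_left mult.assoc)
  also have "\<dots> = (\<Sum>k<n. \<Sum>i<n. A' $$ (k,i) * w $ k * cnj (v $ i))"
    by (subst sum.swap) (simp add: sum_distrib_right)
  also have "\<dots> = (\<Sum>k<n. w $ k * cnj (w $ k))"
    by (intro sum.cong refl) (simp add: wk cnj_sum real sum_distrib_left mult_ac)
  finally have "a * complex_of_real (\<Sum>i<n. (cmod (v $ i))\<^sup>2) = complex_of_real (\<Sum>k<n. (cmod (w $ k))\<^sup>2)"
    by (simp add: complex_norm_square del: of_real_power)
  moreover have "(\<Sum>i<n. (cmod (v $ i))\<^sup>2) > 0"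
  proof -
    obtain i where i: "i < n" "v $ i \<noteq> 0" using v(1,2) by (metis carrier_vecD eq_vecI index_zero_vec)
    then show ?thesis by (intro sum_pos2[of _ i]) auto
  qed
  moreover have "(\<Sum>k<n. (cmod (w $ k))\<^sup>2) \<ge> 0" by (simp add: sum_nonneg)
  ultimately obtain s t where st: "a * complex_of_real s = complex_of_real t" "s > 0" "t \<ge> 0" by blast
  then have "a = complex_of_real (t / s)" by (simp add: field_simps)
  then show "a \<in> \<real>" "Re a \<ge> 0" using st by (auto simp del: of_real_divide)
qed

text \<open>\<open>sing_vals\<close> collects real roots only; it has length \<open>n\<close>
  because the complex factorization of the characteristic polynomial descends to the reals.\<close>

lemma gram_char_poly_splits:
  fixes A :: "real mat"
  assumes A: "A \<in> carrier_mat n n"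
  obtains es where "char_poly (transpose_mat A * A) = (\<Prod>e\<leftarrow>es. [:- e, 1:])" "length es = n" "\<forall>e\<in>set es. e \<ge> 0"
proof -
  let ?B = "transpose_mat A * A" and ?c = "map_mat complex_of_real"
  have B: "?B \<in> carrier_mat n n" using A by simp
  then have cB: "?c ?B \<in> carrier_mat n n" by simp
  obtain as where as: "char_poly (?c ?B) = (\<Prod>a\<leftarrow>as. [:- a, 1:])" "length as = n"
    using char_poly_factorized[OF cB] by blast
  have re: "a = complex_of_real (Re a)" "Re a \<ge> 0" if "a \<in> set as" for a
  proof -
    have "poly (char_poly (?c ?B)) a = 0"
      using that unfolding as(1) by (auto simp: poly_prod_list prod_list_zero_iff)
    then have "eigenvalue (?c ?B) a" using eigenvalue_root_char_poly[OF cB] by simp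
    from gram_eigenvalue_complex[OF A this] show "a = complex_of_real (Re a)" "Re a \<ge> 0" by auto
  qed
  interpret ph: map_poly_inj_idom_hom complex_of_real ..
  have "map_poly complex_of_real (char_poly ?B) = (\<Prod>a\<leftarrow>as. [:- a, 1:])"
    using of_real_hom.char_poly_hom[OF B] as(1) by metis
  also have "\<dots> = (\<Prod>a\<leftarrow>map Re as. [:- complex_of_real a, 1:])"
    using re(1) by (auto simp: o_def intro!: arg_cong[of _ _ prod_list])
  also have "\<dots> = map_poly complex_of_real (\<Prod>a\<leftarrow>map Re as. [:- a, 1:])"
    by (simp add: ph.hom_prod_list o_def)
  finally have "char_poly ?B = (\<Prod>a\<leftarrow>map Re as. [:- a, 1:])"
    by (metis ph.eq_iff)
  then show ?thesis by (rule that) (use as(2) re(2) in auto)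
qed

lemma proots_prod_list_linear: "proots (\<Prod>e\<leftarrow>es. [:- e, 1::real:]) = mset es"
proof (induction es)
  case (Cons a es)
  have "(\<Prod>e\<leftarrow>es. [:- e, 1::real:]) \<noteq> 0" by (auto simp: prod_list_zero_iff)
  then have "proots ([:- a, 1:] * (\<Prod>e\<leftarrow>es. [:- e, 1::real:])) = add_mset a (mset es)"
    using Cons.IH by (subst proots_mult) auto
  then show ?case by simp
qed simp

text \<open>Replaces sorted root lists by extrema of one eigenvalue list. Its members are
  characterized as eigenvalues, which allows comparison with the Gram matrix of the transposed
  inverse, and its sum provides the link to the Frobenius norm.\<close>

lemma sing_vals_gram:
  fixes A :: "real mat"
  assumes A: "A \<in> carrier_mat n n" and n: "n > 0"
  obtains es where "\<And>e. e \<in> set es \<longleftrightarrow> eigenvalue (transpose_mat A * A) e" "length es = n"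
    "\<forall>e\<in>set es. e \<ge> 0" "sum_list es = frob2 A" "es \<noteq> []"
    "sigma 1 A = sqrt (Max (set es))" "sigma n A = sqrt (Min (set es))"
proof -
  let ?B = "transpose_mat A * A"
  have B: "?B \<in> carrier_mat n n" using A by simp
  obtain es where es: "char_poly ?B = (\<Prod>e\<leftarrow>es. [:- e, 1:])" "length es = n" "\<forall>e\<in>set es. e \<ge> 0"
    using gram_char_poly_splits[OF A] by blast
  have ne: "es \<noteq> []" using es(2) n by auto
  have sv: "sing_vals A = map sqrt (rev (sort es))"
    by (simp add: sing_vals_def es(1) proots_prod_list_linear)
  define s where "s = sort es"
  have s: "sorted s" "set s = set es" "length s = n" by (auto simp: s_def es)
  \<comment> \<open>The list of singular values runs through \<open>s\<close> backwards, so the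
    first singular value belongs to the last and largest entry of \<open>s\<close>.\<close>
  have "sigma 1 A = sqrt (s ! (n - 1))"
    using s n by (simp add: sigma_def sv rev_nth flip: s_def)
  moreover have "s ! (n - 1) = Max (set es)"
  proof (rule Max_eqI[symmetric])
    show "y \<le> s ! (n - 1)" if "y \<in> set es" for y
      using that s n unfolding s(2)[symmetric] by (auto simp: in_set_conv_nth intro!: sorted_nth_mono)
    show "s ! (n - 1) \<in> set es" using s n nth_mem[of "n - 1" s] by simp
  qed simp
  moreover have "sigma n A = sqrt (s ! 0)"
    using s n by (simp add: sigma_def sv rev_nth flip: s_def)
  moreover have "s ! 0 = Min (set es)"
  proof (rule Min_eqI[symmetric])
    show "s ! 0 \<le> y" if "y \<in> set es" for y
      using that s n unfolding s(2)[symmetric] by (auto simp: in_set_conv_nth intro!: sorted_nth_mono)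
    show "s ! 0 \<in> set es" using s n nth_mem[of 0 s] by simp
  qed simp
  moreover have "e \<in> set es \<longleftrightarrow> eigenvalue ?B e" for e
    unfolding eigenvalue_root_char_poly[OF B] es(1) by (auto simp: poly_prod_list prod_list_zero_iff)
  moreover have "sum_list es = frob2 A"
    using mtrace_eq_sum_eigenvalues[OF B es(1)] mtrace_gram[OF A] by simp
  ultimately show ?thesis using es ne by (intro that[of es]) auto
qed

lemma eigenvalue_inverse:
  fixes B D :: "'a::field mat"
  assumes B: "B \<in> carrier_mat n n" and D: "D \<in> carrier_mat n n" and BD: "B * D = 1\<^sub>m n"
    and f: "eigenvalue D f"
  shows "f \<noteq> 0" "eigenvalue B (1 / f)"
proof -
  obtain v where v: "v \<in> carrier_vec n" "v \<noteq> 0\<^sub>v n" "D *\<^sub>v v = f \<cdot>\<^sub>v v"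
    using f D unfolding eigenvalue_def eigenvector_def by auto
  have "v = (B * D) *\<^sub>v v" using v BD by simp
  also have "\<dots> = B *\<^sub>v (f \<cdot>\<^sub>v v)" using B D v by (simp add: assoc_mult_mat_vec[of _ n n _ n])
  also have "\<dots> = f \<cdot>\<^sub>v (B *\<^sub>v v)" using B v by (simp add: mult_mat_vec)
  finally have eq: "v = f \<cdot>\<^sub>v (B *\<^sub>v v)" .
  have Bv: "B *\<^sub>v v \<in> carrier_vec n" using B v by simp
  show "f \<noteq> 0"
  proof
    assume "f = 0"
    moreover have "0 \<cdot>\<^sub>v u = 0\<^sub>v n" if "u \<in> carrier_vec n" for u :: "'a vec"
      using that by (intro eq_vecI) auto
    ultimately show False using v(2) eq Bv by simp
  qed
  then have "(1 / f) \<cdot>\<^sub>v v = B *\<^sub>v v"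
    using arg_cong[OF eq, of "\<lambda>u. (1 / f) \<cdot>\<^sub>v u"] Bv by (simp add: smult_smult_assoc)
  then show "eigenvalue B (1 / f)" using v B unfolding eigenvalue_def eigenvector_def by auto
qed

text \<open>The eigenvalues of the Gram matrix of \<open>A\<close> are the inverses of those of the Gram matrix of
  the transposed inverse.\<close>
lemma sigma_ratio_bounds:
  fixes A A' :: "real mat"
  assumes A: "A \<in> carrier_mat n n" and A': "A' \<in> carrier_mat n n" and inv: "A * A' = 1\<^sub>m n" "A' * A = 1\<^sub>m n"
    and n: "n > 0"
  shows "sqrt (frob2 A * frob2 A') / n \<le> sigma_ratio 1 n A"
    "sigma_ratio 1 n A \<le> sqrt (frob2 A * frob2 A')" "0 \<le> sigma_ratio 1 n A"
proof -
  define T where "T = transpose_mat A'"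
  have T: "T \<in> carrier_mat n n" using A' by (simp add: T_def)
  let ?B = "transpose_mat A * A" and ?D = "transpose_mat T * T"
  have B: "?B \<in> carrier_mat n n" and D: "?D \<in> carrier_mat n n" using A T by auto
  have TA: "T * transpose_mat A = 1\<^sub>m n" "transpose_mat A * T = 1\<^sub>m n"
    using inv A A' by (auto simp: T_def simp flip: transpose_mult)
  have "?B * ?D = transpose_mat A * ((A * A') * T)"
    using A A' T by (simp add: T_def assoc_mult_mat[of _ n n _ n _ n])
  then have BD: "?B * ?D = 1\<^sub>m n" using TA inv T by simp
  have "?D * ?B = A' * ((T * transpose_mat A) * A)"
    using A A' T by (simp add: T_def assoc_mult_mat[of _ n n _ n _ n])
  then have DB: "?D * ?B = 1\<^sub>m n" using TA inv A by simp
  obtain es where es: "\<And>e. e \<in> set es \<longleftrightarrow> eigenvalue ?B e" "length es = n"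
    "\<forall>e\<in>set es. e \<ge> 0" "sum_list es = frob2 A" "es \<noteq> []"
    "sigma 1 A = sqrt (Max (set es))" "sigma n A = sqrt (Min (set es))"
    using sing_vals_gram[OF A n] by blast
  obtain fs where fs: "\<And>e. e \<in> set fs \<longleftrightarrow> eigenvalue ?D e" "length fs = n"
    "\<forall>e\<in>set fs. e \<ge> 0" "sum_list fs = frob2 T" "fs \<noteq> []"
    using sing_vals_gram[OF T n] by blast
  have fT: "frob2 T = frob2 A'" by (simp add: T_def frob2_transpose)
  have e_pos: "e > 0" "1 / e \<in> set fs" if "e \<in> set es" for e
    using eigenvalue_inverse[OF D B DB, of e] that es(1,3) fs(1) by force+
  have f_pos: "f > 0" "1 / f \<in> set es" if "f \<in> set fs" for f
    using eigenvalue_inverse[OF B D BD, of f] that fs(1,3) es(1) by force+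
  have sum_le: "sum_list xs \<le> length xs * Max (set xs)" for xs :: "real list"
    using sum_list_mono[of xs "\<lambda>x. x" "\<lambda>_. Max (set xs)"] by (simp add: sum_list_triv)
  have le_sum: "x \<le> sum_list xs" if "\<forall>x\<in>set xs. x \<ge> 0" "x \<in> set xs" for x and xs :: "real list"
    using member_le_sum_list[of x xs] that
    by (induction xs) (auto simp: sum_list_nonneg add_increasing add_increasing2)
  define M where "M = Max (set es)"
  define \<mu> where "\<mu> = Min (set es)"
  define N where "N = Max (set fs)"
  have mem: "M \<in> set es" "\<mu> \<in> set es" "N \<in> set fs" using es(5) fs(5) by (auto simp: M_def \<mu>_def N_def)
  \<comment> \<open>A sum of \<open>n\<close> nonnegative eigenvalues lies between the largest one
    and \<open>n\<close> times it. Applied to both Gram matrices, this produces the loss factor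
    \<open>n\<close> in the lower bound.\<close>
  have M: "frob2 A \<le> n * M" "M \<le> frob2 A"
    using sum_le[of es] le_sum[of es M] es mem by (auto simp: M_def)
  have "N * \<mu> = 1"
  proof -
    have "1 / \<mu> \<le> N" using e_pos[OF mem(2)] by (simp add: N_def)
    moreover have "\<mu> \<le> 1 / N" using f_pos[OF mem(3)] by (simp add: \<mu>_def)
    ultimately show ?thesis
      using e_pos(1)[OF mem(2)] f_pos(1)[OF mem(3)] by (intro antisym) (auto simp: field_simps)
  qed
  have N: "frob2 A' \<le> n * N" "N \<le> frob2 A'"
    using sum_le[of fs] le_sum[of fs N] fs mem fT by (auto simp: N_def)
  have pos: "M > 0" "\<mu> > 0" "N > 0" using e_pos f_pos mem by auto
  have "\<mu> = 1 / N" using \<open>N * \<mu> = 1\<close> pos by (simp add: field_simps)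
  then have ratio: "sigma_ratio 1 n A = sqrt (M * N)"
    unfolding sigma_ratio_def es(6,7) M_def[symmetric] \<mu>_def[symmetric]
    by (simp add: real_sqrt_divide real_sqrt_mult)
  show "0 \<le> sigma_ratio 1 n A" unfolding ratio using pos by simp
  show "sigma_ratio 1 n A \<le> sqrt (frob2 A * frob2 A')"
    unfolding ratio using M N pos by (intro real_sqrt_le_mono mult_mono) auto
  have "sqrt (frob2 A * frob2 A') \<le> sqrt ((n * M) * (n * N))"
    using M N pos frob2_nonneg by (intro real_sqrt_le_mono mult_mono) auto
  also have "\<dots> = n * sqrt (M * N)" by (simp add: real_sqrt_mult)
  finally show "sqrt (frob2 A * frob2 A') / n \<le> sigma_ratio 1 n A"
    unfolding ratio using n by (simp add: field_simps)
qed

section \<open>Congruence subgroups\<close>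

lemma SL_simps [simp]:
  "x \<in> carrier (SL d) \<longleftrightarrow> x \<in> carrier_mat d d \<and> det x = 1"
  "mult (SL d) = (*)" "one (SL d) = 1\<^sub>m d"
  by (auto simp: SL_def)

text \<open>With determinant 1 the adjugate is the inverse. Its entries are cofactors, hence bounded
  as soon as the entries of \<open>A\<close> are.\<close>

lemma adj_mat_SL:
  assumes "A \<in> carrier (SL d)"
  shows "adj_mat A \<in> carrier (SL d)" "adj_mat A * A = 1\<^sub>m d" "A * adj_mat A = 1\<^sub>m d"
proof -
  have A: "A \<in> carrier_mat d d" "det A = 1" using assms by auto
  note adj = adj_mat[OF A(1)]
  show l: "adj_mat A * A = 1\<^sub>m d" "A * adj_mat A = 1\<^sub>m d" using adj A(2) by auto
  have "det (adj_mat A) * det A = 1" using det_mult[OF adj(1) A(1)] l by simp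
  then show "adj_mat A \<in> carrier (SL d)" using adj A by simp
qed

lemma group_SL: "group (SL d)"
proof (rule groupI)
  show "\<exists>y\<in>carrier (SL d). y \<otimes>\<^bsub>SL d\<^esub> x = \<one>\<^bsub>SL d\<^esub>" if "x \<in> carrier (SL d)" for x
    using adj_mat_SL[OF that] by (intro bexI[of _ "adj_mat x"]) auto
qed (auto simp: det_mult)

lemma inv_SL: "A \<in> carrier (SL d) \<Longrightarrow> inv\<^bsub>SL d\<^esub> A = adj_mat A"
  using adj_mat_SL[of A d] by (intro group.inv_equality[OF group_SL]) auto

lemma subgroup_SLD:
  assumes "subgroup \<Gamma> (SL d)"
  shows "x \<in> \<Gamma> \<Longrightarrow> x \<in> carrier (SL d)" "x \<in> \<Gamma> \<Longrightarrow> y \<in> \<Gamma> \<Longrightarrow> x * y \<in> \<Gamma>" "1\<^sub>m d \<in> \<Gamma>"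
    "x \<in> \<Gamma> \<Longrightarrow> adj_mat x \<in> \<Gamma>"
  using subgroup.mem_carrier[OF assms] subgroup.m_closed[OF assms, of x y] subgroup.one_closed[OF assms]
    subgroup.m_inv_closed[OF assms, of x] inv_SL[of x d]
  by auto

section \<open>Bounded parts of discrete groups\<close>

lemma finite_mats_entries:
  assumes "finite R"
  shows "finite {M \<in> carrier_mat nr nc. \<forall>i<nr. \<forall>j<nc. M $$ (i,j) \<in> R}"
proof (rule finite_subset)
  show "{M \<in> carrier_mat nr nc. \<forall>i<nr. \<forall>j<nc. M $$ (i,j) \<in> R}
    \<subseteq> mat nr nc ` (({..<nr} \<times> {..<nc}) \<rightarrow>\<^sub>E R)"
  proof
    fix M assume M: "M \<in> {M \<in> carrier_mat nr nc. \<forall>i<nr. \<forall>j<nc. M $$ (i,j) \<in> R}"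
    then have "M = mat nr nc (restrict (($$) M) ({..<nr} \<times> {..<nc}))"
      by (intro eq_matI) auto
    moreover have "restrict (($$) M) ({..<nr} \<times> {..<nc}) \<in> ({..<nr} \<times> {..<nc}) \<rightarrow>\<^sub>E R"
      using M by auto
    ultimately show "M \<in> mat nr nc ` (({..<nr} \<times> {..<nc}) \<rightarrow>\<^sub>E R)" by blast
  qed
qed (intro finite_imageI finite_PiE finite_cartesian_product assms finite_lessThan)

lemma abs_det_le:
  fixes A :: "real mat"
  assumes "A \<in> carrier_mat n n" "\<And>i j. i < n \<Longrightarrow> j < n \<Longrightarrow> \<bar>A $$ (i,j)\<bar> \<le> B"
  shows "\<bar>det A\<bar> \<le> fact n * B ^ n"
proof -
  have "\<bar>det A\<bar> \<le> (\<Sum>p | p permutes {0..<n}. \<bar>signof p * (\<Prod>i = 0..<n. A $$ (i, p i))\<bar>)"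
    unfolding det_def'[OF assms(1)] by (rule sum_abs)
  also have "\<dots> \<le> (\<Sum>p | p permutes {0..<n}. B ^ n)"
  proof (intro sum_mono)
    fix p assume p: "p \<in> {p. p permutes {0..<n}}"
    have "\<bar>signof p * (\<Prod>i = 0..<n. A $$ (i, p i))\<bar> = (\<Prod>i = 0..<n. \<bar>A $$ (i, p i)\<bar>)"
      by (simp add: abs_mult abs_prod sign_def)
    also have "\<dots> \<le> (\<Prod>i = 0..<n. B)"
      using p permutes_in_image[of p "{0..<n}"] by (intro prod_mono) (auto intro!: assms(2))
    finally show "\<bar>signof p * (\<Prod>i = 0..<n. A $$ (i, p i))\<bar> \<le> B ^ n" by simp
  qed
  also have "\<dots> = fact n * B ^ n" by (simp add: card_permutations[of _ n])
  finally show ?thesis .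
qed

lemma abs_adj_mat_le:
  fixes A :: "real mat"
  assumes "A \<in> carrier_mat n n" "\<And>i j. i < n \<Longrightarrow> j < n \<Longrightarrow> \<bar>A $$ (i,j)\<bar> \<le> B" "i < n" "j < n"
  shows "\<bar>adj_mat A $$ (i,j)\<bar> \<le> fact (n - 1) * B ^ (n - 1)"
proof -
  have "\<bar>det (mat_delete A j i)\<bar> \<le> fact (n - 1) * B ^ (n - 1)"
  proof (rule abs_det_le)
    show "mat_delete A j i \<in> carrier_mat (n - 1) (n - 1)" using mat_delete_carrier[OF assms(1)] .
    show "\<bar>mat_delete A j i $$ (k, l)\<bar> \<le> B" if "k < n - 1" "l < n - 1" for k l
      using that assms(1) by (auto simp: mat_delete_def intro!: assms(2))
  qed
  then show ?thesis using assms by (simp add: adj_mat_def cofactor_def abs_mult)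
qed

text \<open>\<open>mat_discrete\<close> isolates each point with a radius of its own. The group
  structure makes the radius uniform on bounded parts: \<open>x^-1 y - 1 = x^-1 (y - x)\<close> is
  small when \<open>y - x\<close> is, since the entries of \<open>x^-1\<close> are bounded, so
  isolation of the identity is enough.\<close>

lemma finite_bounded_of_discrete:
  assumes \<Gamma>: "subgroup \<Gamma> (SL d)" "mat_discrete d \<Gamma>"
  shows "finite {g \<in> \<Gamma>. \<forall>i<d. \<forall>j<d. \<bar>g $$ (i,j)\<bar> \<le> B}" (is "finite ?X")
proof -
  note G = subgroup_SLD[OF \<Gamma>(1)]
  obtain e where e: "e > 0" "\<And>y. y \<in> \<Gamma> \<Longrightarrow> \<forall>i<d. \<forall>j<d. \<bar>y $$ (i,j) - 1\<^sub>m d $$ (i,j)\<bar> < e \<Longrightarrow> y = 1\<^sub>m d"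
    using bspec[OF \<Gamma>(2)[unfolded mat_discrete_def] G(3)] by auto
  define M where "M = fact (d - 1) * \<bar>B\<bar> ^ (d - 1)"
  have "M \<ge> 0" by (simp add: M_def)
  \<comment> \<open>Chosen so that \<open>d * M * \<eta> < e\<close>, where
    \<open>d * M * \<eta>\<close> bounds the entries of \<open>x^-1 (y - x)\<close>; the summand 1
    makes the inequality strict and covers \<open>M = 0\<close>.\<close>
  define \<eta> where "\<eta> = e / (d * M + 1)"
  have pos: "d * M + 1 > 0" using \<open>M \<ge> 0\<close> by (simp add: add_nonneg_pos)
  then have "\<eta> > 0" using e by (simp add: \<eta>_def)
  have lt: "d * (M * \<eta>) < e"
  proof -
    have "(d * M + 1) * \<eta> = e" using pos by (simp add: \<eta>_def)
    then show ?thesis using \<open>\<eta> > 0\<close> by (simp add: algebra_simps)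
  qed
  have close: "x = y" if x: "x \<in> ?X" and y: "y \<in> ?X"
    and xy: "\<And>i j. i < d \<Longrightarrow> j < d \<Longrightarrow> \<bar>y $$ (i,j) - x $$ (i,j)\<bar> \<le> \<eta>" for x y
  proof -
    have xc: "x \<in> carrier (SL d)" and yc: "y \<in> carrier (SL d)" using G(1) x y by auto
    note adj = adj_mat_SL[OF xc]
    have "\<bar>(adj_mat x * y) $$ (i,j) - 1\<^sub>m d $$ (i,j)\<bar> < e" if ij: "i < d" "j < d" for i j
    proof -
      have "(adj_mat x * y) $$ (i,j) - 1\<^sub>m d $$ (i,j) =
          (\<Sum>k<d. adj_mat x $$ (i,k) * (y $$ (k,j) - x $$ (k,j)))"
        unfolding adj(2)[symmetric] using adj(1) xc yc ij
        by (subst (1 2) mult_entry[of _ d d _ d]) (auto simp: algebra_simps sum_subtractf)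
      also have "\<bar>\<dots>\<bar> \<le> (\<Sum>k<d. \<bar>adj_mat x $$ (i,k) * (y $$ (k,j) - x $$ (k,j))\<bar>)" by (rule sum_abs)
      also have "\<dots> \<le> (\<Sum>k<d. M * \<eta>)"
      proof (intro sum_mono)
        fix k assume k: "k \<in> {..<d}"
        have "\<bar>x $$ (a,b)\<bar> \<le> \<bar>B\<bar>" if "a < d" "b < d" for a b
        proof -
          have "\<bar>x $$ (a,b)\<bar> \<le> B" using x that by blast
          then show ?thesis by linarith
        qed
        then have "\<bar>adj_mat x $$ (i,k)\<bar> \<le> M"
          unfolding M_def using k ij xc by (intro abs_adj_mat_le) auto
        then show "\<bar>adj_mat x $$ (i,k) * (y $$ (k,j) - x $$ (k,j))\<bar> \<le> M * \<eta>"
          unfolding abs_mult using k ij xy \<open>M \<ge> 0\<close> by (intro mult_mono) auto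
      qed
      also have "\<dots> < e" using lt by simp
      finally show ?thesis .
    qed
    then have "adj_mat x * y = 1\<^sub>m d" using x y by (intro e G(2) G(4)) auto
    then have "x * (adj_mat x * y) = x" using xc by auto
    then have "(x * adj_mat x) * y = x" using adj(1) xc yc by (subst assoc_mult_mat[of _ d d _ d _ d]) auto
    then show ?thesis using adj(3) yc by auto
  qed
  define N where "N = \<lceil>\<bar>B\<bar> / \<eta>\<rceil> + 1"
  \<comment> \<open>Pigeonhole on a grid of mesh \<open>\<eta>\<close>: two elements with all
    entries in the same cells coincide, and bounded entries meet only finitely many cells.\<close>
  define \<Phi> where "\<Phi> g = mat d d (\<lambda>ij. \<lfloor>g $$ ij / \<eta>\<rfloor>)" for g :: "real mat"
  have "inj_on \<Phi> ?X"
  proof (rule inj_onI)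
    fix x y assume x: "x \<in> ?X" and y: "y \<in> ?X" and eq: "\<Phi> x = \<Phi> y"
    show "x = y"
    proof (rule close[OF x y])
      fix i j assume ij: "i < d" "j < d"
      have "\<Phi> x $$ (i,j) = \<Phi> y $$ (i,j)" by (simp add: eq)
      then have "\<lfloor>x $$ (i,j) / \<eta>\<rfloor> = \<lfloor>y $$ (i,j) / \<eta>\<rfloor>" using ij by (simp add: \<Phi>_def)
      then have "\<bar>y $$ (i,j) / \<eta> - x $$ (i,j) / \<eta>\<bar> \<le> 1" by linarith
      then have "\<bar>y $$ (i,j) - x $$ (i,j)\<bar> / \<eta> \<le> 1"
        using \<open>\<eta> > 0\<close> by (simp add: abs_divide flip: diff_divide_distrib)
      then show "\<bar>y $$ (i,j) - x $$ (i,j)\<bar> \<le> \<eta>" using \<open>\<eta> > 0\<close> by simp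
    qed
  qed
  moreover have "\<Phi> ` ?X \<subseteq> {M \<in> carrier_mat d d. \<forall>i<d. \<forall>j<d. M $$ (i,j) \<in> {-N..N}}"
  proof (clarsimp simp: \<Phi>_def)
    fix g i j assume "g \<in> \<Gamma>" "\<forall>i<d. \<forall>j<d. \<bar>g $$ (i,j)\<bar> \<le> B" "i < d" "j < d"
    then have "\<bar>g $$ (i,j)\<bar> \<le> \<bar>B\<bar>" by fastforce
    then have "\<bar>g $$ (i,j) / \<eta>\<bar> \<le> \<bar>B\<bar> / \<eta>" using \<open>\<eta> > 0\<close> by (simp add: abs_divide divide_right_mono)
    then show "- N \<le> \<lfloor>g $$ (i,j) / \<eta>\<rfloor> \<and> \<lfloor>g $$ (i,j) / \<eta>\<rfloor> \<le> N" unfolding N_def by linarith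
  qed
  ultimately show ?thesis
    by (rule inj_on_finite) (intro finite_mats_entries finite_atLeastAtMost_int)
qed

section \<open>Reduction of matrix entries modulo an ideal of finite quotient\<close>

lemma entries_generated:
  assumes A: "unital_subring A" and S: "S \<subseteq> carrier (SL d)"
    and ent: "\<And>s i j. s \<in> S \<Longrightarrow> i < d \<Longrightarrow> j < d \<Longrightarrow> s $$ (i,j) \<in> A \<and> adj_mat s $$ (i,j) \<in> A"
    and g: "g \<in> generate (SL d) S" and ij: "i < d" "j < d"
  shows "g $$ (i,j) \<in> A"
proof -
  note AD = unital_subringD[OF A]
  interpret group "SL d" by (rule group_SL)
  have "g \<in> carrier (SL d) \<and> (\<forall>i<d. \<forall>j<d. g $$ (i,j) \<in> A)"
    using g
  proof induction
    case one
    then show ?case using AD by auto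
  next
    case (incl h)
    then show ?case using S ent by auto
  next
    case (inv h)
    then show ?case using S ent inv_SL[of h d] adj_mat_SL[of h d] by auto
  next
    case (eng h1 h2)
    then show ?case
      by (auto simp: mult_entry[of _ d d _ d] det_mult simp del: index_mult_mat(1) intro!: unital_subring_sum[OF A] AD)
  qed
  then show ?thesis using ij by blast
qed

text \<open>Each excluded \<open>f\<close> differs from the identity in some entry. The product
  \<open>a\<close> of these differences is a single nonzero element of the ring of entries; modulo
  an ideal in which \<open>a\<close> is a unit, none of the factors vanishes, so one principal
  congruence subgroup avoids all of \<open>F\<close>.\<close>

lemma finite_index_avoiding:
  assumes \<Gamma>: "subgroup \<Gamma> (SL d)" and S: "finite S" "S \<subseteq> carrier (SL d)" "generate (SL d) S = \<Gamma>"
    and F: "finite F" "1\<^sub>m d \<notin> F"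
  obtains H where "finite_index_sub d H \<Gamma>" "H \<inter> F = {}"
proof -
  interpret group "SL d" by (rule group_SL)
  note G = subgroup_SLD[OF \<Gamma>]
  define E where "E = (\<lambda>(s,ij). s $$ ij) ` (S \<times> ({..<d} \<times> {..<d})) \<union>
    (\<lambda>(s,ij). adj_mat s $$ ij) ` (S \<times> ({..<d} \<times> {..<d}))"
  have "finite E" unfolding E_def using S by auto
  then obtain A where A: "unital_subring A" "E \<subseteq> A" "residually_finite A"
    by (rule finitely_generated_residually_finite)
  note AD = unital_subringD[OF A(1)]
  have ent: "g $$ (i,j) \<in> A" if "g \<in> \<Gamma>" "i < d" "j < d" for g i j
    using that unfolding S(3)[symmetric]
    by (intro entries_generated[OF A(1) S(2)]) (use A(2) in \<open>auto simp: E_def\<close>)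
  have one_ent: "1\<^sub>m d $$ (i,j) \<in> A" if "i < d" "j < d" for i j using that AD by auto
  have "\<exists>ij. fst ij < d \<and> snd ij < d \<and> f $$ ij \<noteq> 1\<^sub>m d $$ ij" if "f \<in> F \<inter> \<Gamma>" for f
  proof (rule ccontr)
    assume "\<not> ?thesis"
    then have "f = 1\<^sub>m d" using G(1)[of f] that by (intro eq_matI) auto
    with F that show False by blast
  qed
  then obtain w where w: "\<And>f. f \<in> F \<inter> \<Gamma> \<Longrightarrow> fst (w f) < d \<and> snd (w f) < d \<and> f $$ w f \<noteq> 1\<^sub>m d $$ w f"
    by metis
  define a where "a = (\<Prod>f\<in>F \<inter> \<Gamma>. f $$ w f - 1\<^sub>m d $$ w f)"
  have wA: "f $$ w f - 1\<^sub>m d $$ w f \<in> A" if "f \<in> F \<inter> \<Gamma>" for f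
    using w[OF that] ent[of f "fst (w f)" "snd (w f)"] one_ent[of "fst (w f)" "snd (w f)"] that
    by (intro AD) auto
  then have "a \<in> A" unfolding a_def by (intro unital_subring_prod A) auto
  moreover have "a \<noteq> 0" unfolding a_def using w F by (auto simp: prod_zero_iff)
  ultimately obtain I a' where I: "ideal_in A I" "1 \<notin> I" "finite_quotient A I" "a' \<in> A" "a * a' - 1 \<in> I"
    using A(3) unfolding residually_finite_def by blast
  note ID = ideal_inD[OF I(1)]
  note Idiff = ideal_in_diff[OF A(1) I(1)]
  define cong where "cong X Y \<longleftrightarrow> (\<forall>i<d. \<forall>j<d. X $$ (i,j) - Y $$ (i,j) \<in> I)" for X Y :: "real mat"
  have cong_sym: "cong Y X" if "cong X Y" for X Y
    using that Idiff(1) unfolding cong_def by (metis minus_diff_eq)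
  have cong_trans: "cong X Z" if "cong X Y" "cong Y Z" for X Y Z
    unfolding cong_def
  proof (intro allI impI)
    fix i j assume "i < d" "j < d"
    then have "(X $$ (i,j) - Y $$ (i,j)) + (Y $$ (i,j) - Z $$ (i,j)) \<in> I"
      using that unfolding cong_def by (intro ID(3)) auto
    then show "X $$ (i,j) - Z $$ (i,j) \<in> I" by simp
  qed
  have cong_l: "cong (X * Y) (X * Z)" if X: "X \<in> \<Gamma>" and Y: "Y \<in> \<Gamma>" and Z: "Z \<in> \<Gamma>" and "cong Y Z" for X Y Z
    unfolding cong_def
  proof (intro allI impI)
    fix i j assume ij: "i < d" "j < d"
    have "(X * Y) $$ (i,j) - (X * Z) $$ (i,j) = (\<Sum>k<d. X $$ (i,k) * (Y $$ (k,j) - Z $$ (k,j)))"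
      using G(1)[OF X] G(1)[OF Y] G(1)[OF Z] ij
      by (subst (1 2) mult_entry[of _ d d _ d]) (auto simp: algebra_simps sum_subtractf)
    also have "\<dots> \<in> I" using ij that unfolding cong_def by (intro ideal_in_sum[OF I(1)] ID(4) ent) auto
    finally show "(X * Y) $$ (i,j) - (X * Z) $$ (i,j) \<in> I" .
  qed
  have cong_r: "cong (Y * X) (Z * X)" if X: "X \<in> \<Gamma>" and Y: "Y \<in> \<Gamma>" and Z: "Z \<in> \<Gamma>" and "cong Y Z" for X Y Z
    unfolding cong_def
  proof (intro allI impI)
    fix i j assume ij: "i < d" "j < d"
    have "(Y * X) $$ (i,j) - (Z * X) $$ (i,j) = (\<Sum>k<d. (Y $$ (i,k) - Z $$ (i,k)) * X $$ (k,j))"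
      using G(1)[OF X] G(1)[OF Y] G(1)[OF Z] ij
      by (subst (1 2) mult_entry[of _ d d _ d]) (auto simp: algebra_simps sum_subtractf)
    also have "\<dots> \<in> I" using ij that unfolding cong_def by (intro ideal_in_sum[OF I(1)] ID(5) ent) auto
    finally show "(Y * X) $$ (i,j) - (Z * X) $$ (i,j) \<in> I" .
  qed
  define H where "H = {g \<in> \<Gamma>. cong g (1\<^sub>m d)}"
  have sub: "subgroup H (SL d)"
  proof (rule subgroupI)
    show "H \<subseteq> carrier (SL d)" using G(1) by (auto simp: H_def)
    have "1\<^sub>m d \<in> H" using G(3) ID(2) by (auto simp: H_def cong_def)
    then show "H \<noteq> {}" by blast
    show "inv\<^bsub>SL d\<^esub> x \<in> H" if "x \<in> H" for x
    proof -
      have x: "x \<in> \<Gamma>" "cong x (1\<^sub>m d)" using that by (auto simp: H_def)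
      note adj = adj_mat_SL[OF G(1)[OF x(1)]]
      have "cong (adj_mat x * x) (adj_mat x * 1\<^sub>m d)" using x by (intro cong_l G) auto
      then have "cong (1\<^sub>m d) (adj_mat x)" using adj by auto
      then show ?thesis using inv_SL[OF G(1)[OF x(1)]] G(4)[OF x(1)] cong_sym by (auto simp: H_def)
    qed
    show "x \<otimes>\<^bsub>SL d\<^esub> y \<in> H" if "x \<in> H" "y \<in> H" for x y
    proof -
      have x: "x \<in> \<Gamma>" "cong x (1\<^sub>m d)" and y: "y \<in> \<Gamma>" "cong y (1\<^sub>m d)" using that by (auto simp: H_def)
      have "cong (x * y) (x * 1\<^sub>m d)" using x y by (intro cong_l G) auto
      then have "cong (x * y) x" using G(1)[OF x(1)] by auto
      then show ?thesis using cong_trans x y G(2) by (auto simp: H_def)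
    qed
  qed
  obtain R where R: "finite R" "\<And>a. a \<in> A \<Longrightarrow> \<exists>r\<in>R. a - r \<in> I"
    using I(3) unfolding finite_quotient_def by blast
  define r where "r x = (SOME r. r \<in> R \<and> x - r \<in> I)" for x
  have r: "r x \<in> R" "x - r x \<in> I" if "x \<in> A" for x
    using someI_ex[of "\<lambda>r. r \<in> R \<and> x - r \<in> I"] R(2)[OF that] by (auto simp: r_def)
  define \<rho> where "\<rho> g = mat d d (\<lambda>ij. r (g $$ ij))" for g
  \<comment> \<open>Elements with the same chosen residues are congruent, hence differ by an element
    of \<open>H\<close>; the number of cosets is therefore at most the number of residue
    matrices.\<close>
  have coset: "H #>\<^bsub>SL d\<^esub> g = H #>\<^bsub>SL d\<^esub> h" if g: "g \<in> \<Gamma>" and h: "h \<in> \<Gamma>" and eq: "\<rho> g = \<rho> h" for g h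
  proof -
    have "cong h g" unfolding cong_def
    proof (intro allI impI)
      fix i j assume ij: "i < d" "j < d"
      have "\<rho> g $$ (i,j) = \<rho> h $$ (i,j)" by (simp add: eq)
      then have "r (g $$ (i,j)) = r (h $$ (i,j))" using ij by (simp add: \<rho>_def)
      moreover have "(h $$ (i,j) - r (h $$ (i,j))) - (g $$ (i,j) - r (g $$ (i,j))) \<in> I"
        using ij g h by (intro Idiff r ent)
      ultimately show "h $$ (i,j) - g $$ (i,j) \<in> I" by simp
    qed
    note adj = adj_mat_SL[OF G(1)[OF g]]
    have "cong (h * adj_mat g) (g * adj_mat g)" using \<open>cong h g\<close> g h by (intro cong_r G) auto
    then have "h * adj_mat g \<in> H" using g h adj G(2,4) by (auto simp: H_def)
    moreover have "(h * adj_mat g) * g = h"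
      using adj G(1)[OF g] G(1)[OF h] by (subst assoc_mult_mat[of _ d d _ d _ d]) auto
    ultimately have "h \<in> H #>\<^bsub>SL d\<^esub> g" unfolding r_coset_def
      by (intro UN_I[of "h * adj_mat g"]) auto
    then show ?thesis by (rule repr_independence) (use sub G(1)[OF g] in auto)
  qed
  have "finite (\<rho> ` \<Gamma>)"
  proof (rule finite_subset)
    show "\<rho> ` \<Gamma> \<subseteq> {M \<in> carrier_mat d d. \<forall>i<d. \<forall>j<d. M $$ (i,j) \<in> R}"
      using r(1) ent by (auto simp: \<rho>_def)
  qed (intro finite_mats_entries R)
  then have "finite ((\<lambda>M. H #>\<^bsub>SL d\<^esub> (SOME g. g \<in> \<Gamma> \<and> \<rho> g = M)) ` \<rho> ` \<Gamma>)" by simp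
  moreover have "{H #>\<^bsub>SL d\<^esub> g |g. g \<in> \<Gamma>} \<subseteq> (\<lambda>M. H #>\<^bsub>SL d\<^esub> (SOME g. g \<in> \<Gamma> \<and> \<rho> g = M)) ` \<rho> ` \<Gamma>"
  proof clarify
    fix g assume g: "g \<in> \<Gamma>"
    define h where "h = (SOME h. h \<in> \<Gamma> \<and> \<rho> h = \<rho> g)"
    have h: "h \<in> \<Gamma> \<and> \<rho> h = \<rho> g" unfolding h_def by (rule someI[of _ g]) (use g in auto)
    have "H #>\<^bsub>SL d\<^esub> g = H #>\<^bsub>SL d\<^esub> h" by (rule coset) (use g h in auto)
    then show "H #>\<^bsub>SL d\<^esub> g \<in> (\<lambda>M. H #>\<^bsub>SL d\<^esub> (SOME g. g \<in> \<Gamma> \<and> \<rho> g = M)) ` \<rho> ` \<Gamma>"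
      unfolding h_def by (rule image_eqI) (rule imageI[OF g])
  qed
  ultimately have "finite {H #>\<^bsub>SL d\<^esub> g |g. g \<in> \<Gamma>}" by (rule rev_finite_subset)
  then have "finite_index_sub d H \<Gamma>"
    using sub unfolding finite_index_sub_def by (auto simp: H_def)
  moreover have "H \<inter> F = {}"
  proof (rule ccontr)
    assume "H \<inter> F \<noteq> {}"
    then obtain f where f: "f \<in> F \<inter> \<Gamma>" "cong f (1\<^sub>m d)" by (auto simp: H_def)
    have fin: "finite (F \<inter> \<Gamma>)" using F by auto
    have "f $$ w f - 1\<^sub>m d $$ w f \<in> I" using f(2) w[OF f(1)] unfolding cong_def by (metis prod.collapse)
    moreover have "a = (f $$ w f - 1\<^sub>m d $$ w f) * (\<Prod>f\<in>F \<inter> \<Gamma> - {f}. f $$ w f - 1\<^sub>m d $$ w f)"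
      unfolding a_def using fin f(1) by (rule prod.remove)
    ultimately have "a \<in> I" using wA by (auto intro!: ID(5) unital_subring_prod A(1))
    then have "a * a' - (a * a' - 1) \<in> I" by (intro Idiff(2) ID(5) I)
    with I(2) show False by simp
  qed
  ultimately show ?thesis by (rule that)
qed

section \<open>The representation\<close>

text \<open>The first \<open>d * d\<close> coordinates are the entries of a \<open>d \<times> d\<close> matrix \<open>X\<close> in row-major order, on which
  \<open>g\<close> acts by \<open>X \<mapsto> g X g\<^sup>T\<close>; the remaining ones are fixed.\<close>
definition conj_rep :: "nat \<Rightarrow> nat \<Rightarrow> real mat \<Rightarrow> real mat" where
  "conj_rep d m g = mat m m (\<lambda>(a,b). if a < d * d \<and> b < d * d
     then g $$ (a div d, b div d) * g $$ (a mod d, b mod d) else if a = b then 1 else 0)"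

text \<open>The pair \<open>(X, t)\<close> occupies the first \<open>d * d + 1\<close> coordinates;
  the remaining ones only fill up the prescribed dimension and stay zero.\<close>

definition emb :: "nat \<Rightarrow> nat \<Rightarrow> real mat \<Rightarrow> real \<Rightarrow> real vec" where
  "emb d m X t = vec m (\<lambda>a. if a < d * d then X $$ (a div d, a mod d) else if a = d * d then t else 0)"

text \<open>As a vector this is the identity matrix in row-major coordinates; as a linear functional
  it is the trace, and \<open>tau\<close> is that functional on the whole space.\<close>

definition diag_ind :: "nat \<Rightarrow> nat \<Rightarrow> real" where
  "diag_ind d a = (if a < d * d \<and> a div d = a mod d then 1 else 0)"

text \<open>The rank-one perturbation \<open>v \<mapsto> v + (q \<bullet> v) p\<close> of the identity is a reflection because \<open>q \<bullet> p = - 2\<close>;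
  on \<open>(X, t)\<close> it adds \<open>tr X + t\<close> times the identity to \<open>X\<close>.\<close>
definition refl_p :: "nat \<Rightarrow> nat \<Rightarrow> real" where
  "refl_p d a = diag_ind d a - (if a = d * d then d + 2 else 0)"

definition refl_q :: "nat \<Rightarrow> nat \<Rightarrow> real" where
  "refl_q d a = diag_ind d a + (if a = d * d then 1 else 0)"

definition refl_mat :: "nat \<Rightarrow> nat \<Rightarrow> real mat" where
  "refl_mat d m = mat m m (\<lambda>(a,b). (if a = b then 1 else 0) + refl_p d a * refl_q d b)"

definition tau :: "nat \<Rightarrow> real vec \<Rightarrow> real" where
  "tau d v = (\<Sum>a<d * d. diag_ind d a * v $ a)"

lemma sum_div_mod: "(\<Sum>a<d * d. F (a div d) (a mod d)) = (\<Sum>i<d. \<Sum>j<d. F i j)"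
  for F :: "nat \<Rightarrow> nat \<Rightarrow> 'a::comm_monoid_add"
proof (cases "d = 0")
  case False
  have lt: "i * d + j < d * d" if "i < d" "j < d" for i j
  proof -
    have "i * d + j < Suc i * d" using that by simp
    also have "\<dots> \<le> d * d" using that by (intro mult_le_mono1) simp
    finally show ?thesis .
  qed
  have "(\<Sum>i<d. \<Sum>j<d. F i j) = (\<Sum>(i,j)\<in>{..<d} \<times> {..<d}. F i j)" by (rule sum.cartesian_product)
  also have "\<dots> = (\<Sum>a<d * d. F (a div d) (a mod d))"
    by (rule sum.reindex_bij_witness[of _ "\<lambda>a. (a div d, a mod d)" "\<lambda>(i,j). i * d + j"])
      (use False in \<open>auto simp: less_mult_imp_div_less lt\<close>)
  finally show ?thesis by simp
qed simp

lemma sum_diag_ind: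
  fixes F :: "nat \<Rightarrow> nat \<Rightarrow> real"
  shows "(\<Sum>a<d * d. diag_ind d a * F (a div d) (a mod d)) = (\<Sum>i<d. F i i)"
proof -
  have "(\<Sum>a<d * d. diag_ind d a * F (a div d) (a mod d)) =
      (\<Sum>a<d * d. if a div d = a mod d then F (a div d) (a mod d) else 0)"
    by (intro sum.cong) (auto simp: diag_ind_def)
  also have "\<dots> = (\<Sum>i<d. \<Sum>j<d. if i = j then F i j else 0)" by (rule sum_div_mod)
  also have "\<dots> = (\<Sum>i<d. F i i)" by (simp add: sum.delta)
  finally show ?thesis .
qed

lemma mult_vec_entry:
  "A \<in> carrier_mat n m \<Longrightarrow> v \<in> carrier_vec m \<Longrightarrow> a < n \<Longrightarrow> (A *\<^sub>v v) $ a = (\<Sum>b<m. A $$ (a,b) * v $ b)"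
  by (auto simp: scalar_prod_def atLeast0LessThan)

lemma conj_rep_carrier [simp]: "conj_rep d m g \<in> carrier_mat m m"
  by (simp add: conj_rep_def)

lemma refl_mat_carrier [simp]: "refl_mat d m \<in> carrier_mat m m"
  by (simp add: refl_mat_def)

lemma emb_carrier [simp]: "emb d m X t \<in> carrier_vec m"
  by (simp add: emb_def)

context
  fixes d m :: nat
  assumes d: "d > 0" and m: "d * d < m"
begin

lemma div_mod_less: "a < d * d \<Longrightarrow> a div d < d" "a mod d < d"
  using d by (auto simp: less_mult_imp_div_less)

lemma sum_split_block: "(\<Sum>a<m. f a) = (\<Sum>a<d * d. f a) + (\<Sum>a\<in>{d * d..<m}. f a)" for f :: "nat \<Rightarrow> real"
proof -
  have "{..<m} = {..<d * d} \<union> {d * d..<m}" using m by auto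
  then show ?thesis by (simp add: sum.union_disjoint ivl_disj_int)
qed

lemma conj_rep_one: "conj_rep d m (1\<^sub>m d) = 1\<^sub>m m"
proof (rule eq_matI)
  fix a b assume "a < dim_row (1\<^sub>m m)" "b < dim_col (1\<^sub>m m)"
  then have ab: "a < m" "b < m" by auto
  show "conj_rep d m (1\<^sub>m d) $$ (a,b) = 1\<^sub>m m $$ (a,b)"
  proof (cases "a < d * d \<and> b < d * d")
    case True
    have "a = b \<longleftrightarrow> a div d = b div d \<and> a mod d = b mod d" by (metis div_mult_mod_eq)
    then show ?thesis using ab True div_mod_less by (simp add: conj_rep_def)
  qed (use ab in \<open>auto simp: conj_rep_def\<close>)
qed (auto simp: conj_rep_def)

text \<open>On the block this is the product rule for Kronecker squares: the sum over
  \<open>c\<close> factors into sums over its quotient and its remainder modulo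
  \<open>d\<close>.\<close>

lemma conj_rep_mult:
  assumes g: "g \<in> carrier_mat d d" and h: "h \<in> carrier_mat d d"
  shows "conj_rep d m (g * h) = conj_rep d m g * conj_rep d m h"
proof (rule eq_matI)
  fix a b assume "a < dim_row (conj_rep d m g * conj_rep d m h)" "b < dim_col (conj_rep d m g * conj_rep d m h)"
  then have ab: "a < m" "b < m" by (auto simp: conj_rep_def)
  have "(conj_rep d m g * conj_rep d m h) $$ (a,b) = (\<Sum>c<m. conj_rep d m g $$ (a,c) * conj_rep d m h $$ (c,b))"
    using ab by (intro mult_entry) auto
  also have "\<dots> = conj_rep d m (g * h) $$ (a,b)"
  proof (cases "a < d * d")
    case True
    have z: "(\<Sum>c\<in>{d * d..<m}. conj_rep d m g $$ (a,c) * conj_rep d m h $$ (c,b)) = 0"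
      using True ab by (intro sum.neutral) (auto simp: conj_rep_def)
    show ?thesis
    proof (cases "b < d * d")
      case b: True
      have "(\<Sum>c<d * d. conj_rep d m g $$ (a,c) * conj_rep d m h $$ (c,b)) =
        (\<Sum>c<d * d. (g $$ (a div d, c div d) * h $$ (c div d, b div d)) *
          (g $$ (a mod d, c mod d) * h $$ (c mod d, b mod d)))"
        using True b ab m by (intro sum.cong) (auto simp: conj_rep_def)
      also have "\<dots> = (\<Sum>i<d. \<Sum>j<d. (g $$ (a div d, i) * h $$ (i, b div d)) *
          (g $$ (a mod d, j) * h $$ (j, b mod d)))"
        by (rule sum_div_mod)
      also have "\<dots> = (g * h) $$ (a div d, b div d) * (g * h) $$ (a mod d, b mod d)"
        using True b div_mod_less
        by (simp add: mult_entry[OF g h] sum_product del: index_mult_mat(1))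
      finally show ?thesis unfolding sum_split_block z using True b ab by (simp add: conj_rep_def)
    next
      case b: False
      have "(\<Sum>c<d * d. conj_rep d m g $$ (a,c) * conj_rep d m h $$ (c,b)) = 0"
        using True b ab by (intro sum.neutral) (auto simp: conj_rep_def)
      then show ?thesis unfolding sum_split_block z using True b ab by (auto simp: conj_rep_def)
    qed
  next
    case False
    have "(\<Sum>c<m. conj_rep d m g $$ (a,c) * conj_rep d m h $$ (c,b)) =
        (\<Sum>c<m. if c = a then conj_rep d m h $$ (c,b) else 0)"
      using False ab by (intro sum.cong) (auto simp: conj_rep_def)
    also have "\<dots> = conj_rep d m (g * h) $$ (a,b)"
      using False ab by (auto simp: conj_rep_def)
    finally show ?thesis .
  qed
  finally show "conj_rep d m (g * h) $$ (a,b) = (conj_rep d m g * conj_rep d m h) $$ (a,b)" by simp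
qed (auto simp: conj_rep_def)

lemma conj_rep_emb:
  assumes g: "g \<in> carrier_mat d d" and X: "X \<in> carrier_mat d d"
  shows "conj_rep d m g *\<^sub>v emb d m X t = emb d m (g * X * transpose_mat g) t"
proof (rule eq_vecI)
  fix a assume "a < dim_vec (emb d m (g * X * transpose_mat g) t)"
  then have a: "a < m" by (simp add: emb_def)
  have "(conj_rep d m g *\<^sub>v emb d m X t) $ a = (\<Sum>b<m. conj_rep d m g $$ (a,b) * emb d m X t $ b)"
    using a by (intro mult_vec_entry) auto
  also have "\<dots> = emb d m (g * X * transpose_mat g) t $ a"
  proof (cases "a < d * d")
    case True
    have z: "(\<Sum>b\<in>{d * d..<m}. conj_rep d m g $$ (a,b) * emb d m X t $ b) = 0"
      using True a by (intro sum.neutral) (auto simp: conj_rep_def)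
    have "(\<Sum>b<d * d. conj_rep d m g $$ (a,b) * emb d m X t $ b) =
      (\<Sum>b<d * d. g $$ (a div d, b div d) * X $$ (b div d, b mod d) * g $$ (a mod d, b mod d))"
      using True a m by (intro sum.cong) (auto simp: conj_rep_def emb_def)
    also have "\<dots> = (\<Sum>i<d. \<Sum>j<d. g $$ (a div d, i) * X $$ (i,j) * g $$ (a mod d, j))"
      by (rule sum_div_mod)
    also have "\<dots> = (\<Sum>j<d. (\<Sum>i<d. g $$ (a div d, i) * X $$ (i,j)) * g $$ (a mod d, j))"
      by (subst sum.swap) (simp add: sum_distrib_right)
    also have "\<dots> = (g * X * transpose_mat g) $$ (a div d, a mod d)"
      using g X True div_mod_less
      by (subst mult_entry[of _ d d _ d]) (auto simp: mult_entry[OF g X] simp del: index_mult_mat(1))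
    finally show ?thesis unfolding sum_split_block z using True a by (simp add: emb_def)
  next
    case False
    have "(\<Sum>b<m. conj_rep d m g $$ (a,b) * emb d m X t $ b) = (\<Sum>b<m. if b = a then emb d m X t $ b else 0)"
      using False a by (intro sum.cong) (auto simp: conj_rep_def)
    then show ?thesis using False a by (auto simp: emb_def)
  qed
  finally show "(conj_rep d m g *\<^sub>v emb d m X t) $ a = emb d m (g * X * transpose_mat g) t $ a" .
qed (auto simp: emb_def conj_rep_def)

lemma sum_refl_q: "(\<Sum>b<m. refl_q d b * f b) = (\<Sum>b<d * d. diag_ind d b * f b) + f (d * d)" for f :: "nat \<Rightarrow> real"
proof -
  have "(\<Sum>b<d * d. refl_q d b * f b) = (\<Sum>b<d * d. diag_ind d b * f b)"
    by (intro sum.cong) (auto simp: refl_q_def)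
  moreover have "(\<Sum>b\<in>{d * d..<m}. refl_q d b * f b) = (\<Sum>b\<in>{d * d..<m}. if b = d * d then f b else 0)"
    by (intro sum.cong) (auto simp: refl_q_def diag_ind_def)
  ultimately show ?thesis unfolding sum_split_block using m by simp
qed

text \<open>The identity matrix contributes its trace \<open>d\<close> and the last coordinate
  \<open>-(d + 2)\<close>; this fixes the constant in \<open>refl_p\<close>.\<close>

lemma sum_refl_q_p: "(\<Sum>b<m. refl_q d b * refl_p d b) = - 2"
proof -
  have "(\<Sum>b<d * d. diag_ind d b * refl_p d b) = (\<Sum>b<d * d. diag_ind d b * 1)"
    by (intro sum.cong) (auto simp: refl_p_def diag_ind_def)
  also have "\<dots> = d" using sum_diag_ind[of d "\<lambda>_ _. 1"] by simp
  finally show ?thesis unfolding sum_refl_q by (simp add: refl_p_def diag_ind_def)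
qed

lemma refl_mat_square: "refl_mat d m * refl_mat d m = 1\<^sub>m m"
proof (rule eq_matI)
  fix a b assume "a < dim_row (1\<^sub>m m)" "b < dim_col (1\<^sub>m m)"
  then have ab: "a < m" "b < m" by auto
  let ?p = "refl_p d" and ?q = "refl_q d"
  have "(refl_mat d m * refl_mat d m) $$ (a,b) =
     (\<Sum>c<m. ((if a = c then 1 else 0) + ?p a * ?q c) * ((if c = b then 1 else 0) + ?p c * ?q b))"
    using ab by (subst mult_entry[of _ m m _ m]) (auto simp: refl_mat_def)
  also have "\<dots> = (\<Sum>c<m. (if c = a then (if a = b then 1 else 0) + ?p a * ?q b else 0) +
      (if c = b then ?p a * ?q b else 0) + ?p a * ?q b * (?q c * ?p c))"
    by (intro sum.cong) (auto simp: algebra_simps)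
  also have "\<dots> = (if a = b then 1 else 0)"
    using ab by (simp add: sum.distrib sum_refl_q_p flip: sum_distrib_left)
  finally show "(refl_mat d m * refl_mat d m) $$ (a,b) = 1\<^sub>m m $$ (a,b)" using ab by simp
qed (auto simp: refl_mat_def)

lemma tau_emb: "X \<in> carrier_mat d d \<Longrightarrow> tau d (emb d m X t) = mtrace X"
proof -
  assume X: "X \<in> carrier_mat d d"
  have "tau d (emb d m X t) = (\<Sum>a<d * d. diag_ind d a * X $$ (a div d, a mod d))"
    unfolding tau_def using m by (intro sum.cong) (auto simp: emb_def)
  then show ?thesis using sum_diag_ind[of d "\<lambda>i j. X $$ (i,j)"] X by (simp add: mtrace_def)
qed

lemma refl_mat_vec:
  assumes "v \<in> carrier_vec m" "a < m"
  shows "(refl_mat d m *\<^sub>v v) $ a = v $ a + refl_p d a * (tau d v + v $ (d * d))"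
proof -
  have "(refl_mat d m *\<^sub>v v) $ a = (\<Sum>b<m. refl_mat d m $$ (a,b) * v $ b)"
    using assms by (intro mult_vec_entry) auto
  also have "\<dots> = (\<Sum>b<m. (if b = a then v $ b else 0) + refl_p d a * (refl_q d b * v $ b))"
    using assms by (intro sum.cong) (auto simp: refl_mat_def algebra_simps)
  also have "\<dots> = v $ a + refl_p d a * (\<Sum>b<m. refl_q d b * v $ b)"
    using assms by (simp add: sum.distrib flip: sum_distrib_left)
  finally show ?thesis by (simp add: sum_refl_q tau_def)
qed

text \<open>Here \<open>s\<close> is the value of the functional \<open>refl_q\<close> on
  \<open>(X, t)\<close>. When \<open>|t|\<close> is at most half the trace of \<open>X\<close>, it
  is at least the other half, which moves \<open>X\<close> into the interior of the cone unless the
  trace is zero.\<close>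

lemma refl_mat_emb:
  fixes s t :: real
  assumes X: "X \<in> carrier_mat d d" and s: "s = mtrace X + t"
  shows "refl_mat d m *\<^sub>v emb d m X t = emb d m (X + s \<cdot>\<^sub>m 1\<^sub>m d) (t - (real d + 2) * s)"
proof (rule eq_vecI)
  fix a assume "a < dim_vec (emb d m (X + s \<cdot>\<^sub>m 1\<^sub>m d) (t - (real d + 2) * s))"
  then have a: "a < m" by (simp add: emb_def)
  have dd: "emb d m X t $ (d * d) = t" using m by (simp add: emb_def)
  have "(refl_mat d m *\<^sub>v emb d m X t) $ a = emb d m X t $ a + refl_p d a * s"
    using a by (simp add: refl_mat_vec tau_emb[OF X] dd s)
  also have "\<dots> = emb d m (X + s \<cdot>\<^sub>m 1\<^sub>m d) (t - (real d + 2) * s) $ a"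
    using a X div_mod_less by (auto simp: emb_def refl_p_def diag_ind_def)
  finally show "(refl_mat d m *\<^sub>v emb d m X t) $ a = emb d m (X + s \<cdot>\<^sub>m 1\<^sub>m d) (t - (real d + 2) * s) $ a" .
qed (auto simp: emb_def refl_mat_def)

end

section \<open>Positive semidefinite matrices and traces\<close>

definition psd :: "nat \<Rightarrow> real mat \<Rightarrow> bool" where
  "psd d X \<longleftrightarrow> X \<in> carrier_mat d d \<and> (\<forall>x\<in>carrier_vec d. x \<bullet> (X *\<^sub>v x) \<ge> 0)"

lemma mtrace_psd_nonneg:
  assumes "psd d X"
  shows "mtrace X \<ge> 0"
proof -
  have X: "X \<in> carrier_mat d d" using assms by (simp add: psd_def)
  have "X $$ (i,i) \<ge> 0" if "i < d" for i
  proof -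
    have "unit_vec d i \<bullet> (X *\<^sub>v unit_vec d i) = X $$ (i,i)"
      using X that by simp
    then show ?thesis using assms that by (metis psd_def unit_vec_carrier)
  qed
  then show ?thesis using X by (auto simp: mtrace_def intro!: sum_nonneg)
qed

lemma psd_conj:
  assumes g: "g \<in> carrier_mat d d" and X: "psd d X"
  shows "psd d (g * X * transpose_mat g)"
proof -
  have Xc: "X \<in> carrier_mat d d" using X by (simp add: psd_def)
  have "x \<bullet> ((g * X * transpose_mat g) *\<^sub>v x) \<ge> 0" if x: "x \<in> carrier_vec d" for x
  proof -
    define y where "y = transpose_mat g *\<^sub>v x"
    have y: "y \<in> carrier_vec d" using g x by (simp add: y_def)
    have "(g * X * transpose_mat g) *\<^sub>v x = g *\<^sub>v (X *\<^sub>v y)"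
      using g Xc x by (simp add: y_def assoc_mult_mat_vec[of _ d d _ d])
    then have "x \<bullet> ((g * X * transpose_mat g) *\<^sub>v x) = y \<bullet> (X *\<^sub>v y)"
      using g Xc x y by (simp add: y_def transpose_vec_mult_scalar[of g d d])
    then show ?thesis using X y by (simp add: psd_def)
  qed
  then show ?thesis using g Xc by (simp add: psd_def)
qed

lemma psd_add_scalar:
  assumes "psd d X" "s \<ge> 0"
  shows "psd d (X + s \<cdot>\<^sub>m 1\<^sub>m d)"
proof -
  have X: "X \<in> carrier_mat d d" using assms by (simp add: psd_def)
  have scalar_mat_vec: "(s \<cdot>\<^sub>m 1\<^sub>m d) *\<^sub>v x = s \<cdot>\<^sub>v x" if "x \<in> carrier_vec d" for x :: "real vec"
    using that by (intro eq_vecI) auto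
  have "x \<bullet> ((X + s \<cdot>\<^sub>m 1\<^sub>m d) *\<^sub>v x) = x \<bullet> (X *\<^sub>v x) + s * (x \<bullet> x)" if x: "x \<in> carrier_vec d" for x
    using X x by (simp add: add_mult_distrib_mat_vec[of _ d d] scalar_prod_add_distrib[of _ d] scalar_mat_vec)
  moreover have "x \<bullet> x \<ge> 0" for x :: "real vec" by (auto simp: scalar_prod_def intro!: sum_nonneg)
  ultimately show ?thesis using X assms by (auto simp: psd_def)
qed

text \<open>The source of all growth: \<open>g * g^T\<close> has trace \<open>frob2 g\<close>, so
  the scalar part of the matrix gains exactly this factor, however \<open>g\<close> acts on
  \<open>X\<close> itself.\<close>

lemma mtrace_conj_scalar:
  assumes g: "g \<in> carrier_mat d d" and X: "X \<in> carrier_mat d d"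
  shows "mtrace (g * (X + s \<cdot>\<^sub>m 1\<^sub>m d) * transpose_mat g) = mtrace (g * X * transpose_mat g) + s * frob2 g"
proof -
  have "g * (X + s \<cdot>\<^sub>m 1\<^sub>m d) * transpose_mat g = g * X * transpose_mat g + s \<cdot>\<^sub>m (g * transpose_mat g)"
    using g X by (simp add: mult_add_distrib_mat[of _ d d _ d] add_mult_distrib_mat[of _ d d _ _ d]
        mult_smult_distrib[of _ d d _ d] mult_smult_assoc_mat[of _ d d _ d])
  then have "mtrace (g * (X + s \<cdot>\<^sub>m 1\<^sub>m d) * transpose_mat g) =
      mtrace (g * X * transpose_mat g) + s * mtrace (g * transpose_mat g)"
    using g X by (simp add: mtrace_def sum.distrib sum_distrib_left del: index_mult_mat(1))
  also have "mtrace (g * transpose_mat g) = frob2 g"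
    using mtrace_gram[of "transpose_mat g" d d] g by (simp add: frob2_transpose)
  finally show ?thesis .
qed

section \<open>Reduced words\<close>

lemma reduced_word_iff:
  "reduced_word d H1 H2 ws \<longleftrightarrow>
    (\<forall>x\<in>set ws. snd x \<in> (if fst x then H2 else H1) \<and> snd x \<noteq> 1\<^sub>m d) \<and>
    successively (\<lambda>x y. fst x \<noteq> fst y) ws"
  unfolding reduced_word_def successively_conv_nth all_set_conv_all_nth by blast

lemma fp_eval_Nil [simp]: "fp_eval m rho1 rho2 [] = 1\<^sub>m m"
  by (simp add: fp_eval_def)

lemma fp_eval_Cons [simp]:
  "fp_eval m rho1 rho2 (x # ws) = (if fst x then rho2 (snd x) else rho1 (snd x)) * fp_eval m rho1 rho2 ws"
  by (cases x) (simp add: fp_eval_def)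

section \<open>Inverse words and quotients of words\<close>

definition word_inv :: "(bool \<times> real mat) list \<Rightarrow> (bool \<times> real mat) list" where
  "word_inv ws = rev (map (\<lambda>x. (fst x, adj_mat (snd x))) ws)"

lemma reduced_word_ConsD:
  assumes "reduced_word d H1 H2 (x # ws)"
  shows "reduced_word d H1 H2 ws" "snd x \<in> (if fst x then H2 else H1)" "snd x \<noteq> 1\<^sub>m d"
    "ws \<noteq> [] \<Longrightarrow> fst x \<noteq> fst (hd ws)"
  using assms by (auto simp: reduced_word_iff successively_Cons)

text \<open>Serves for the image of the identity under an element of \<open>hom\<close>, which only
  asserts closure and multiplicativity: that image is idempotent with nonzero determinant.\<close>

lemma idempotent_eq_one:
  fixes P :: "'a::field mat"
  assumes P: "P \<in> carrier_mat n n" "P * P = P" "det P \<noteq> 0"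
  shows "P = 1\<^sub>m n"
proof -
  note adj = adj_mat[OF P(1)]
  have "(adj_mat P * P) * P = adj_mat P * P"
    by (simp only: assoc_mult_mat[OF adj(1) P(1) P(1)] P(2))
  then have eq: "det P \<cdot>\<^sub>m P = det P \<cdot>\<^sub>m 1\<^sub>m n"
    using P(1) adj by (simp add: mult_smult_assoc_mat[of _ n n _ n])
  show ?thesis
  proof (rule eq_matI)
    fix i j assume "i < dim_row (1\<^sub>m n :: 'a mat)" "j < dim_col (1\<^sub>m n :: 'a mat)"
    then have ij: "i < n" "j < n" by auto
    have "(det P \<cdot>\<^sub>m P) $$ (i,j) = (det P \<cdot>\<^sub>m 1\<^sub>m n) $$ (i,j)" by (simp only: eq)
    then show "P $$ (i,j) = 1\<^sub>m n $$ (i,j)" using ij P by simp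
  qed (use P in auto)
qed

lemma hom_SL_GLD:
  assumes "\<rho> \<in> hom (SL d) (GL m)"
  shows "g \<in> carrier (SL d) \<Longrightarrow> \<rho> g \<in> carrier_mat m m"
    "g \<in> carrier (SL d) \<Longrightarrow> h \<in> carrier (SL d) \<Longrightarrow> \<rho> (g * h) = \<rho> g * \<rho> h"
    "\<rho> (1\<^sub>m d) = 1\<^sub>m m"
proof -
  have *: "\<rho> g \<in> carrier_mat m m \<and> det (\<rho> g) \<noteq> 0" if "g \<in> carrier (SL d)" for g
    using hom_in_carrier[OF assms that] by (simp add: GL_def)
  show mult: "\<rho> (g * h) = \<rho> g * \<rho> h" if "g \<in> carrier (SL d)" "h \<in> carrier (SL d)" for g h
    using hom_mult[OF assms that] by (simp add: GL_def)
  show "g \<in> carrier (SL d) \<Longrightarrow> \<rho> g \<in> carrier_mat m m" using * by blast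
  have one: "1\<^sub>m d \<in> carrier (SL d)" by simp
  show "\<rho> (1\<^sub>m d) = 1\<^sub>m m"
    by (rule idempotent_eq_one) (use *[OF one] mult[OF one one] in auto)
qed

lemma adj_mat_ne_one:
  assumes "g \<in> carrier (SL d)" "g \<noteq> 1\<^sub>m d"
  shows "adj_mat g \<noteq> 1\<^sub>m d"
  using adj_mat_SL(3)[OF assms(1)] assms by auto

context
  fixes d m :: nat and rho1 rho2 :: "real mat \<Rightarrow> real mat" and H1 H2 :: "real mat set"
  assumes rho: "rho1 \<in> hom (SL d) (GL m)" "rho2 \<in> hom (SL d) (GL m)"
    and H: "subgroup H1 (SL d)" "subgroup H2 (SL d)"
begin

abbreviation "E \<equiv> fp_eval m rho1 rho2"
abbreviation "red \<equiv> reduced_word d H1 H2"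

lemma fp_eval_carrier:
  "\<forall>x\<in>set ws. snd x \<in> carrier (SL d) \<Longrightarrow> E ws \<in> carrier_mat m m"
proof (induction ws)
  case (Cons x ws)
  then show ?case using hom_SL_GLD(1)[OF rho(1), of "snd x"] hom_SL_GLD(1)[OF rho(2), of "snd x"] by auto
qed simp

lemma fp_eval_append:
  "\<forall>x\<in>set us \<union> set vs. snd x \<in> carrier (SL d) \<Longrightarrow> E (us @ vs) = E us * E vs"
proof (induction us)
  case Nil
  then show ?case using fp_eval_carrier[of vs] by auto
next
  case (Cons x us)
  have "\<forall>x\<in>set us. snd x \<in> carrier (SL d)" "\<forall>x\<in>set vs. snd x \<in> carrier (SL d)" using Cons.prems by auto
  then have "E us \<in> carrier_mat m m" "E vs \<in> carrier_mat m m" by (auto simp del: SL_simps intro: fp_eval_carrier)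
  with Cons show ?case using hom_SL_GLD(1)[OF rho(1), of "snd x"] hom_SL_GLD(1)[OF rho(2), of "snd x"]
    by (auto simp: assoc_mult_mat[of _ m m _ m _ m])
qed

lemma red_letters:
  assumes "red ws" "x \<in> set ws"
  shows "snd x \<in> carrier (SL d)"
  using assms subgroup_SLD(1)[OF H(1), of "snd x"] subgroup_SLD(1)[OF H(2), of "snd x"]
  by (auto simp: reduced_word_iff split: if_splits)

lemma red_word_inv:
  assumes "red ws"
  shows "red (word_inv ws)"
proof -
  have "snd x \<in> (if fst x then H2 else H1) \<and> snd x \<noteq> 1\<^sub>m d" if "x \<in> set (word_inv ws)" for x
  proof -
    have "x \<in> (\<lambda>y. (fst y, adj_mat (snd y))) ` set ws" using that by (simp add: word_inv_def)
    then obtain y where y: "y \<in> set ws" "x = (fst y, adj_mat (snd y))" by blast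
    with assms have "snd y \<in> (if fst y then H2 else H1)" "snd y \<noteq> 1\<^sub>m d" by (auto simp: reduced_word_iff)
    then show ?thesis
      using y adj_mat_ne_one[of "snd y"] red_letters[OF assms y(1)]
        subgroup_SLD(4)[OF H(1), of "snd y"] subgroup_SLD(4)[OF H(2), of "snd y"] by (auto split: if_splits)
  qed
  moreover have "successively (\<lambda>x y. fst x \<noteq> fst y) (word_inv ws)"
  proof -
    have "successively (\<lambda>x y. fst x \<noteq> fst y) ws" using assms by (simp add: reduced_word_iff)
    then have "successively (\<lambda>x y. fst y \<noteq> fst x) ws" by (rule successively_mono) simp
    then show ?thesis by (simp add: word_inv_def successively_map)
  qed
  ultimately show ?thesis by (simp add: reduced_word_iff)
qed

lemma fp_eval_letter_inv:
  assumes "g \<in> carrier (SL d)" "h \<in> carrier (SL d)"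
  shows "E [(b, adj_mat g)] * E [(b, h)] = E [(b, adj_mat g * h)]"
  using assms adj_mat_SL(1)[OF assms(1)] hom_SL_GLD(1)[OF rho(1)] hom_SL_GLD(1)[OF rho(2)]
  by (auto simp: hom_SL_GLD(2)[OF rho(1)] hom_SL_GLD(2)[OF rho(2)]
      right_mult_one_mat[of _ m m] mult_carrier_mat[of _ m m _ m] simp del: SL_simps)

lemma E_one: "E [(b, 1\<^sub>m d)] = 1\<^sub>m m"
  using hom_SL_GLD(3)[OF rho(1)] hom_SL_GLD(3)[OF rho(2)] by auto

lemma set_word_inv:
  assumes "red ws" shows "\<forall>x\<in>set (word_inv ws). snd x \<in> carrier (SL d)"
  using red_letters[OF red_word_inv[OF assms]] by blast

text \<open>The two letters meeting at the junction lie in the same factor and merge into one. The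
  merged letter may be trivial, so the resulting word need not be reduced.\<close>

lemma cancel_letter:
  assumes red: "red (x # u)" and vs: "\<forall>y\<in>set (y # vs). snd y \<in> carrier (SL d)" and eq: "fst y = fst x"
  shows "E (word_inv (x # u)) * E (y # vs) = E (word_inv u @ (fst x, adj_mat (snd x) * snd y) # vs)"
proof -
  have u: "red u" using reduced_word_ConsD[OF red] by auto
  obtain b g where x: "x = (b,g)" by (cases x)
  obtain h where y: "y = (b,h)" using eq x by (cases y) auto
  have g: "g \<in> carrier (SL d)" and h: "h \<in> carrier (SL d)" using red_letters[OF red, of x] vs x y by auto
  note adj = adj_mat_SL(1)[OF g]
  have gh: "adj_mat g * h \<in> carrier (SL d)"
    using adj h monoid.m_closed[OF group.is_monoid[OF group_SL], of "adj_mat g" d h] by simp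
  have c: "E (word_inv u) \<in> carrier_mat m m" "E vs \<in> carrier_mat m m" "E [(b, adj_mat g)] \<in> carrier_mat m m"
    "E [(b, h)] \<in> carrier_mat m m" "E [(b, adj_mat g * h)] \<in> carrier_mat m m"
    using set_word_inv[OF u] vs adj h gh by (auto intro!: fp_eval_carrier simp del: fp_eval_Cons SL_simps)
  have "E (word_inv (x # u)) = E (word_inv u) * E [(b, adj_mat g)]"
    using set_word_inv[OF u] adj x unfolding word_inv_def
    by (simp add: fp_eval_append del: fp_eval_Cons SL_simps)
  moreover have "E (y # vs) = E [(b,h)] * E vs"
    using fp_eval_append[of "[(b,h)]" vs] vs y by (simp del: fp_eval_Cons SL_simps)
  ultimately have "E (word_inv (x # u)) * E (y # vs) =
      E (word_inv u) * ((E [(b, adj_mat g)] * E [(b, h)]) * E vs)"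
    using c by (simp add: assoc_mult_mat[of _ m m _ m _ m] del: fp_eval_Cons)
  also have "\<dots> = E (word_inv u) * E ((b, adj_mat g * h) # vs)"
    unfolding fp_eval_letter_inv[OF g h]
    using fp_eval_append[of "[(b, adj_mat g * h)]" vs] vs gh by (simp del: fp_eval_Cons SL_simps)
  also have "\<dots> = E (word_inv u @ (b, adj_mat g * h) # vs)"
    using set_word_inv[OF u] vs gh by (subst fp_eval_append) (auto simp del: fp_eval_Cons SL_simps)
  finally show ?thesis by (simp add: x y)
qed

lemma fp_eval_word_inv:
  assumes "red ws"
  shows "E (word_inv ws) * E ws = 1\<^sub>m m"
  using assms
proof (induction ws)
  case (Cons x u)
  have u: "red u" using reduced_word_ConsD[OF Cons.prems] by auto
  have x: "snd x \<in> carrier (SL d)" using red_letters[OF Cons.prems] by simp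
  have "E (word_inv (x # u)) * E (x # u) = E (word_inv u @ (fst x, 1\<^sub>m d) # u)"
    using cancel_letter[OF Cons.prems, of x u] red_letters[OF Cons.prems] adj_mat_SL(2)[OF x] by simp
  also have "\<dots> = E (word_inv u) * E ([(fst x, 1\<^sub>m d)] @ u)"
    using set_word_inv[OF u] red_letters[OF u] by (subst fp_eval_append) auto
  also have "E ([(fst x, 1\<^sub>m d)] @ u) = E u"
    using fp_eval_carrier[of u] red_letters[OF u] by (subst fp_eval_append) (auto simp: E_one simp del: fp_eval_Cons)
  finally show ?case using Cons.IH[OF u] by simp
qed (simp add: word_inv_def)

text \<open>Cancelling the common prefix of two distinct reduced words leaves a nonempty reduced word.\<close>
lemma word_quotient:
  assumes "red ws" "red ws'" "ws \<noteq> ws'"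
  shows "\<exists>vs. vs \<noteq> [] \<and> red vs \<and> E vs = E (word_inv ws) * E ws'"
  using assms
proof (induction ws arbitrary: ws')
  case Nil
  have "E ws' \<in> carrier_mat m m" using red_letters[OF Nil(2)] by (intro fp_eval_carrier) auto
  then show ?case using Nil by (intro exI[of _ ws']) (auto simp: word_inv_def)
next
  case (Cons x u)
  note red = \<open>red (x # u)\<close>
  have u: "red u" using reduced_word_ConsD[OF red] by auto
  have last_inv: "last (word_inv (x # u)) = (fst x, adj_mat (snd x))" by (simp add: word_inv_def)
  have last_u: "u \<noteq> [] \<Longrightarrow> fst (last (word_inv u)) = fst (hd u)"
    by (cases u) (simp_all add: word_inv_def)
  show ?case
  proof (cases ws')
    case Nil
    have "E (word_inv (x # u)) \<in> carrier_mat m m" using set_word_inv[OF red] by (rule fp_eval_carrier)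
    then show ?thesis
      by (intro exI[of _ "word_inv (x # u)"]) (use red_word_inv[OF red] Nil in \<open>auto simp: word_inv_def\<close>)
  next
    case ws': (Cons y u')
    have u': "red u'" using reduced_word_ConsD(1) Cons.prems(2) ws' by blast
    have all: "\<forall>y\<in>set (y # u'). snd y \<in> carrier (SL d)" using red_letters[OF Cons.prems(2)] ws' by auto
    show ?thesis
    proof (cases "fst y = fst x")
      case False
      have "red (word_inv (x # u) @ ws')"
        using red_word_inv[OF red] Cons.prems(2) False last_inv ws'
        by (auto simp: reduced_word_iff successively_append_iff)
      moreover have "E (word_inv (x # u) @ ws') = E (word_inv (x # u)) * E ws'"
        using set_word_inv[OF red] all ws' by (subst fp_eval_append) auto
      ultimately show ?thesis using ws' by blast
    next
      case True
      note cancel = cancel_letter[OF red all True]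
      have x: "snd x \<in> carrier (SL d)" "snd y \<in> carrier (SL d)" using red_letters[OF red] all by auto
      note adj = adj_mat_SL[OF x(1)]
      show ?thesis
      proof (cases "snd y = snd x")
        case same: True
        then have "u \<noteq> u'" using True Cons.prems(3) ws' by (auto simp: prod_eq_iff)
        from Cons.IH[OF u u' this] obtain vs where vs: "vs \<noteq> []" "red vs" "E vs = E (word_inv u) * E u'" by blast
        have "E (word_inv (x # u)) * E ws' = E (word_inv u @ (fst x, 1\<^sub>m d) # u')"
          using cancel same adj ws' by simp
        also have "\<dots> = E (word_inv u) * E ([(fst x, 1\<^sub>m d)] @ u')"
          using set_word_inv[OF u] all by (subst fp_eval_append) auto
        also have "E ([(fst x, 1\<^sub>m d)] @ u') = E u'"
          using fp_eval_carrier[of u'] all by (subst fp_eval_append) (auto simp: E_one simp del: fp_eval_Cons)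
        finally show ?thesis using vs by auto
      next
        case diff: False
        \<comment> \<open>Cancellation stops here: the merged letter is nontrivial, and both its
          neighbours, the heads of \<open>u\<close> and \<open>u'\<close> if present, belong to the
          other factor.\<close>
        let ?h = "adj_mat (snd x) * snd y"
        have h: "?h \<in> (if fst x then H2 else H1)"
          using reduced_word_ConsD(2)[OF red] reduced_word_ConsD(2)[of d H1 H2 y u'] Cons.prems(2) ws' True
            subgroup_SLD(2,4)[OF H(1)] subgroup_SLD(2,4)[OF H(2)]
          by (auto split: if_splits)
        have ne: "?h \<noteq> 1\<^sub>m d"
        proof
          assume "?h = 1\<^sub>m d"
          then have "snd x * ?h = snd x" using x by auto
          moreover have "snd x * ?h = (snd x * adj_mat (snd x)) * snd y"
            using x adj by (subst assoc_mult_mat[of _ d d _ d _ d]) auto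
          ultimately show False using adj(3) diff x(2) by auto
        qed
        have "red ((fst x, ?h) # u')"
          using Cons.prems(2) ws' True h ne by (auto simp: reduced_word_iff successively_Cons)
        moreover have "u \<noteq> [] \<Longrightarrow> fst (hd u) \<noteq> fst x" using reduced_word_ConsD(4)[OF red] by auto
        ultimately have "red (word_inv u @ (fst x, ?h) # u')"
          using red_word_inv[OF u] last_u
          by (cases "u = []") (auto simp: reduced_word_iff successively_append_iff word_inv_def)
        then show ?thesis using cancel ws' by (metis append_is_Nil_conv list.distinct(1))
      qed
    qed
  qed
qed

end

section \<open>The representation on the second factor\<close>

definition conj_rep' :: "nat \<Rightarrow> nat \<Rightarrow> real mat \<Rightarrow> real mat" where
  "conj_rep' d m g = refl_mat d m * conj_rep d m g * refl_mat d m"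

lemma conj_rep'_carrier [simp]: "conj_rep' d m g \<in> carrier_mat m m"
  unfolding conj_rep'_def by (intro mult_carrier_mat[of _ m m]) auto

lemma conj_rep_hom:
  assumes d: "d > 0" and m: "d * d < m"
  shows "conj_rep d m \<in> hom (SL d) (GL m)" "conj_rep' d m \<in> hom (SL d) (GL m)"
proof -
  let ?R = "conj_rep d m" and ?S = "conj_rep' d m" and ?G = "refl_mat d m"
  have mult: "?R (g * h) = ?R g * ?R h" if "g \<in> carrier (SL d)" "h \<in> carrier (SL d)" for g h
    using that by (intro conj_rep_mult[OF d m]) auto
  have c: "?R g * ?G \<in> carrier_mat m m" "?G * ?R g \<in> carrier_mat m m" for g
    by (intro mult_carrier_mat[of _ m m]; simp)+
  have mult': "?S (g * h) = ?S g * ?S h" if "g \<in> carrier (SL d)" "h \<in> carrier (SL d)" for g h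
  proof -
    have "?S g * ?S h = ?G * (?R g * ((?G * ?G) * (?R h * ?G)))"
      using c by (simp add: conj_rep'_def assoc_mult_mat[of _ m m _ m _ m] mult_carrier_mat[of _ m m _ m])
    also have "\<dots> = ?S (g * h)"
      using c unfolding refl_mat_square[OF d m]
      by (simp add: conj_rep'_def mult[OF that] left_mult_one_mat[of _ m m] assoc_mult_mat[of _ m m _ m _ m] mult_carrier_mat[of _ m m _ m])
    finally show ?thesis by simp
  qed
  have one: "?S (1\<^sub>m d) = 1\<^sub>m m"
    using refl_mat_square[OF d m] by (simp add: conj_rep'_def conj_rep_one[OF d m] right_mult_one_mat[of _ m m])
  have "det (?R g) \<noteq> 0" "det (?S g) \<noteq> 0" if g: "g \<in> carrier (SL d)" for g
  proof -
    note adj = adj_mat_SL[OF g]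
    have "?R g * ?R (adj_mat g) = 1\<^sub>m m" "?S g * ?S (adj_mat g) = 1\<^sub>m m"
      using mult[OF g adj(1)] mult'[OF g adj(1)] adj(3) one conj_rep_one[OF d m] by auto
    then have "det (?R g) * det (?R (adj_mat g)) = 1" "det (?S g) * det (?S (adj_mat g)) = 1"
      by (simp_all flip: det_mult[of _ m])
    then show "det (?R g) \<noteq> 0" "det (?S g) \<noteq> 0" by auto
  qed
  then show "?R \<in> hom (SL d) (GL m)" "?S \<in> hom (SL d) (GL m)"
    using mult mult' by (auto simp: hom_def GL_def simp del: SL_simps(1))
qed

section \<open>Ping-pong\<close>

text \<open>The trace \<open>r\<close> is an explicit parameter because its growth is to be
  measured. The bound on \<open>t\<close> confines \<open>r + t\<close> to the interval from
  \<open>r / 2\<close> to \<open>3 / 2 * r\<close>.\<close>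

definition cone_vec :: "nat \<Rightarrow> nat \<Rightarrow> real \<Rightarrow> real vec \<Rightarrow> bool" where
  "cone_vec d m r v \<longleftrightarrow>
     (\<exists>X t. v = emb d m X t \<and> psd d X \<and> mtrace X = r \<and> \<bar>t\<bar> \<le> r / 2)"

text \<open>The reflection adds at least half the trace times the identity, and \<open>g\<close>
  multiplies this contribution by its squared norm. The last coordinate is enlarged by the
  reflection but untouched by \<open>g\<close>, so a large \<open>g\<close> restores the cone
  condition.\<close>

lemma cone_vec_step:
  assumes d: "d > 0" and m: "d * d < m" and v: "cone_vec d m r v"
    and g: "g \<in> carrier_mat d d" "frob2 g \<ge> 8 * (real d + 2)"
  obtains r' where "r' \<ge> frob2 g / 2 * r" "cone_vec d m r' (conj_rep d m g *\<^sub>v (refl_mat d m *\<^sub>v v))"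
proof -
  obtain X t where X: "v = emb d m X t" "psd d X" "mtrace X = r" "\<bar>t\<bar> \<le> r / 2"
    using v unfolding cone_vec_def by blast
  have Xc: "X \<in> carrier_mat d d" using X(2) by (simp add: psd_def)
  have r: "r \<ge> 0" using mtrace_psd_nonneg[OF X(2)] X(3) by simp
  define s where "s = mtrace X + t"
  have s: "r / 2 \<le> s" "s \<le> 3 / 2 * r" using X(3,4) by (auto simp: s_def)
  define Y where "Y = g * (X + s \<cdot>\<^sub>m 1\<^sub>m d) * transpose_mat g"
  define u where "u = t - (real d + 2) * s"
  have eq: "conj_rep d m g *\<^sub>v (refl_mat d m *\<^sub>v v) = emb d m Y u"
    unfolding X(1) refl_mat_emb[OF d m Xc s_def] Y_def u_def
    using Xc by (intro conj_rep_emb[OF d m g(1)]) auto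
  have Y: "psd d Y"
    unfolding Y_def by (intro psd_conj g psd_add_scalar X) (use s r in auto)
  have "mtrace (g * X * transpose_mat g) \<ge> 0" using mtrace_psd_nonneg[OF psd_conj[OF g(1) X(2)]] .
  then have "mtrace Y \<ge> s * frob2 g"
    unfolding Y_def mtrace_conj_scalar[OF g(1) Xc] by simp
  moreover have "s * frob2 g \<ge> r / 2 * frob2 g" using s frob2_nonneg by (intro mult_right_mono)
  ultimately have tr: "mtrace Y \<ge> frob2 g / 2 * r" by (simp add: algebra_simps)
  define q where "q = (real d + 2) * r"
  have "(real d + 2) * s \<le> (real d + 2) * (3 / 2 * r)" using s by (intro mult_left_mono) auto
  then have "(real d + 2) * s \<le> 3 / 2 * q" by (simp add: q_def)
  moreover have "(real d + 2) * s \<ge> 0" using s r by simp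
  moreover have "r \<le> q" using mult_right_mono[of 1 "real d + 2" r] r by (simp add: q_def)
  ultimately have "\<bar>u\<bar> \<le> 2 * q" unfolding u_def using X(4) r by linarith
  then have "\<bar>u\<bar> \<le> 2 * (real d + 2) * r" by (simp only: q_def mult.assoc)
  \<comment> \<open>The origin of the threshold \<open>8 * (d + 2)\<close>: a last coordinate of
    size up to \<open>2 * (d + 2) * r\<close> must be at most half of the new trace, which is at
    least \<open>frob2 g / 2 * r\<close>.\<close>
  also have "\<dots> \<le> (frob2 g / 4) * r" using g(2) r by (intro mult_right_mono) auto
  also have "\<dots> \<le> mtrace Y / 2" using tr by (simp add: mult.commute)
  finally have "cone_vec d m (mtrace Y) (emb d m Y u)" using Y unfolding cone_vec_def by blast
  with tr show ?thesis by (intro that[of "mtrace Y"]) (simp_all add: eq)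
qed

text \<open>Letters of the second factor act by \<open>G R G\<close> with \<open>G\<close> the
  reflection, those of the first by \<open>R\<close>. As the factors alternate, exactly one
  \<open>G\<close> stands between consecutive \<open>R\<close>. The starting vector \<open>e\<close>
  or \<open>G e\<close> is chosen so that a \<open>G\<close> also precedes the first
  \<open>R\<close> to act, and a second-factor head leaves one \<open>G\<close> in front. The factor
  \<open>d\<close> is the trace of the identity matrix in \<open>e\<close>.\<close>

lemma word_cone:
  assumes d: "d > 0" and m: "d * d < m" and ws: "ws \<noteq> []" "successively (\<lambda>x y. fst x \<noteq> fst y) ws"
    and big: "\<forall>x\<in>set ws. snd x \<in> carrier_mat d d \<and> frob2 (snd x) \<ge> 8 * (real d + 2)"
  defines "e \<equiv> emb d m (1\<^sub>m d) 0"
  shows "\<exists>c r. cone_vec d m r c \<and> r \<ge> d * prod_list (map (\<lambda>x. frob2 (snd x) / 2) ws) \<and>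
    fp_eval m (conj_rep d m) (conj_rep' d m) ws *\<^sub>v (if fst (last ws) then e else refl_mat d m *\<^sub>v e) =
      (if fst (hd ws) then refl_mat d m *\<^sub>v c else c)"
  using ws big
proof (induction ws)
  case (Cons x ws)
  let ?R = "conj_rep d m" and ?S = "conj_rep' d m" and ?G = "refl_mat d m"
  let ?E = "fp_eval m ?R ?S" and ?P = "\<lambda>ws. prod_list (map (\<lambda>x. frob2 (snd x) / 2) ws)"
  let ?g = "snd x"
  have g: "?g \<in> carrier_mat d d" "frob2 ?g \<ge> 8 * (real d + 2)" using Cons.prems by auto
  have ec: "e \<in> carrier_vec m" by (simp add: e_def)
  have GG: "?G *\<^sub>v (?G *\<^sub>v v) = v" if "v \<in> carrier_vec m" for v
    using that refl_mat_square[OF d m] by (simp flip: assoc_mult_mat_vec[of _ m m _ m])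
  have Gv: "?G *\<^sub>v v \<in> carrier_vec m" if "v \<in> carrier_vec m" for v
    using that by (rule mult_mat_vec_carrier[OF refl_mat_carrier])
  have Rv: "?R h *\<^sub>v v \<in> carrier_vec m" if "v \<in> carrier_vec m" for v h
    using that by (rule mult_mat_vec_carrier[OF conj_rep_carrier])
  have Sv: "?S ?g *\<^sub>v v = ?G *\<^sub>v (?R ?g *\<^sub>v (?G *\<^sub>v v))" if "v \<in> carrier_vec m" for v
    using that Gv[OF that]
    by (simp add: conj_rep'_def assoc_mult_mat_vec[of _ m m _ m] mult_carrier_mat[of _ m m _ m])
  have Ec: "?E us \<in> carrier_mat m m" for us
    by (induction us) (auto simp: mult_carrier_mat[of _ m m _ m])
  have cone_c: "c \<in> carrier_vec m" if "cone_vec d m r c" for r c using that by (auto simp: cone_vec_def)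
  have "\<exists>c r. cone_vec d m r c \<and> r \<ge> d * ?P ws \<and>
    ?E ws *\<^sub>v (if fst (last (x # ws)) then e else ?G *\<^sub>v e) = (if fst x then c else ?G *\<^sub>v c)"
  proof (cases "ws = []")
    case True
    have "psd d (1\<^sub>m d)"
      unfolding psd_def by (auto simp: scalar_prod_def intro!: sum_nonneg)
    then have "cone_vec d m d e"
      unfolding cone_vec_def e_def by (intro exI[of _ "1\<^sub>m d"] exI[of _ 0]) (auto simp: mtrace_def)
    then show ?thesis using True ec Gv[OF ec] by (intro exI[of _ e] exI[of _ "real d"]) auto
  next
    case False
    \<comment> \<open>The head of \<open>ws\<close> lies in the factor opposite to \<open>x\<close>,
      so the \<open>G\<close> it leaves in front, or the one that \<open>x\<close> brings along, is
      the only one to act before the \<open>R\<close> of \<open>x\<close>.\<close>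
    then have hd: "(if fst (hd ws) then ?G *\<^sub>v c else c) = (if fst x then c else ?G *\<^sub>v c)" for c
      using Cons.prems(2) by (auto simp: successively_Cons)
    have last: "last (x # ws) = last ws" using False by simp
    have "successively (\<lambda>x y. fst x \<noteq> fst y) ws"
      "\<forall>x\<in>set ws. snd x \<in> carrier_mat d d \<and> frob2 (snd x) \<ge> 8 * (real d + 2)"
      using Cons.prems False by (auto simp: successively_Cons)
    from Cons.IH[OF False this] show ?thesis unfolding last hd .
  qed
  then obtain c r where c: "cone_vec d m r c" "r \<ge> d * ?P ws"
    "?E ws *\<^sub>v (if fst (last (x # ws)) then e else ?G *\<^sub>v e) = (if fst x then c else ?G *\<^sub>v c)" by blast
  obtain r' where r': "r' \<ge> frob2 ?g / 2 * r" "cone_vec d m r' (?R ?g *\<^sub>v (?G *\<^sub>v c))"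
    using cone_vec_step[OF d m c(1) g] by blast
  have "d * ?P (x # ws) = frob2 ?g / 2 * (d * ?P ws)" by simp
  also have "\<dots> \<le> frob2 ?g / 2 * r" using c(2) frob2_nonneg[of ?g] by (intro mult_left_mono) auto
  finally have ge: "r' \<ge> d * ?P (x # ws)" using r'(1) by simp
  define v where "v = (if fst (last (x # ws)) then e else ?G *\<^sub>v e)"
  have v: "v \<in> carrier_vec m" using ec Gv by (simp add: v_def)
  have "?E (x # ws) *\<^sub>v v = (if fst x then ?S ?g else ?R ?g) *\<^sub>v (?E ws *\<^sub>v v)"
    using v Ec by (simp add: assoc_mult_mat_vec[of _ m m _ m])
  also have "\<dots> = (if fst x then ?G *\<^sub>v (?R ?g *\<^sub>v (?G *\<^sub>v c)) else ?R ?g *\<^sub>v (?G *\<^sub>v c))"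
    using c(3) cone_c[OF c(1)] by (simp add: Sv v_def)
  finally show ?case using r'(2) ge by (auto simp: v_def)
qed simp

text \<open>The starting vector is \<open>(I, 0)\<close> or its reflection
  \<open>((1 + d) I, -(d + 2) d)\<close>, which explains the bounds on its entries and on its
  trace.\<close>

lemma tau_word:
  assumes d: "d > 0" and m: "d * d < m" and ws: "ws \<noteq> []" "successively (\<lambda>x y. fst x \<noteq> fst y) ws"
    and big: "\<forall>x\<in>set ws. snd x \<in> carrier_mat d d \<and> frob2 (snd x) \<ge> 8 * (real d + 2)"
  obtains v where "v \<in> carrier_vec m" "\<And>b. b < m \<Longrightarrow> \<bar>v $ b\<bar> \<le> (real d + 2)\<^sup>2" "tau d v \<le> d * (1 + real d)"
    "tau d (fp_eval m (conj_rep d m) (conj_rep' d m) ws *\<^sub>v v) \<ge> d * prod_list (map (\<lambda>x. frob2 (snd x) / 2) ws)"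
proof -
  let ?G = "refl_mat d m"
  define e where "e = emb d m (1\<^sub>m d) 0"
  define v where "v = (if fst (last ws) then e else ?G *\<^sub>v e)"
  obtain c r where c: "cone_vec d m r c" "r \<ge> d * prod_list (map (\<lambda>x. frob2 (snd x) / 2) ws)"
    "fp_eval m (conj_rep d m) (conj_rep' d m) ws *\<^sub>v v = (if fst (hd ws) then ?G *\<^sub>v c else c)"
    using word_cone[OF assms] unfolding v_def e_def by blast
  have one: "mtrace (1\<^sub>m d) = real d" by (simp add: mtrace_def)
  have Ge: "?G *\<^sub>v e = emb d m (1\<^sub>m d + real d \<cdot>\<^sub>m 1\<^sub>m d) (- (real d + 2) * d)"
    unfolding e_def by (subst refl_mat_emb[OF d m]) (auto simp: one algebra_simps)
  have v: "v \<in> carrier_vec m" by (auto simp: v_def Ge) (simp add: e_def)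
  have le: "1 \<le> (real d + 2)\<^sup>2" "1 + real d \<le> (real d + 2)\<^sup>2" "(real d + 2) * d \<le> (real d + 2)\<^sup>2"
    "(2 + real d) * d \<le> (real d + 2)\<^sup>2"
    by (auto simp: power2_eq_square algebra_simps)
  have bound: "\<bar>v $ b\<bar> \<le> (real d + 2)\<^sup>2" if "b < m" for b
    using that le div_mod_less[OF d m]
    by (auto simp: v_def Ge) (auto simp: e_def emb_def abs_mult)
  have "tau d v \<le> d * (1 + real d)"
    by (auto simp: v_def Ge) (auto simp: e_def tau_emb[OF d m] mtrace_def algebra_simps)
  \<comment> \<open>A final reflection can only help: it adds \<open>d * (r + t)\<close> to the
    trace, and \<open>r + t\<close> is nonnegative on the cone.\<close>
  moreover have "tau d (if fst (hd ws) then ?G *\<^sub>v c else c) \<ge> r"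
  proof -
    obtain X t where X: "c = emb d m X t" "psd d X" "mtrace X = r" "\<bar>t\<bar> \<le> r / 2"
      using c(1) unfolding cone_vec_def by blast
    have Xc: "X \<in> carrier_mat d d" using X(2) by (simp add: psd_def)
    have r: "r \<ge> 0" using mtrace_psd_nonneg[OF X(2)] X(3) by simp
    have "mtrace (X + s \<cdot>\<^sub>m 1\<^sub>m d) = mtrace X + d * s" for s :: real
      using Xc by (simp add: mtrace_def sum.distrib)
    moreover have "r + t \<ge> 0" using X(4) r by linarith
    ultimately show ?thesis
      using Xc by (simp add: X(1) refl_mat_emb[OF d m Xc refl] tau_emb[OF d m] X(3))
  qed
  ultimately show ?thesis using c(2,3) v bound by (intro that[of v]) auto
qed

section \<open>From growth of the trace to norms, discreteness and singular values\<close>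

lemma abs_tau_mult_le:
  assumes m: "d * d < m" and M: "M \<in> carrier_mat m m" "\<And>a b. a < m \<Longrightarrow> b < m \<Longrightarrow> \<bar>M $$ (a,b)\<bar> \<le> \<eta>"
    and v: "v \<in> carrier_vec m" "\<And>b. b < m \<Longrightarrow> \<bar>v $ b\<bar> \<le> V"
  shows "\<bar>tau d (M *\<^sub>v v)\<bar> \<le> real m * real m * (\<eta> * V)"
proof -
  have pos: "0 \<le> \<eta>" "0 \<le> V" using M(2)[of 0 0] v(2)[of 0] m by force+
  have "\<bar>(M *\<^sub>v v) $ a\<bar> \<le> m * (\<eta> * V)" if a: "a < m" for a
  proof -
    have "(M *\<^sub>v v) $ a = (\<Sum>b<m. M $$ (a,b) * v $ b)" using a by (intro mult_vec_entry[OF M(1) v(1)])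
    also have "\<bar>\<dots>\<bar> \<le> (\<Sum>b<m. \<bar>M $$ (a,b) * v $ b\<bar>)" by (rule sum_abs)
    also have "\<dots> \<le> (\<Sum>b<m. \<eta> * V)"
      unfolding abs_mult using a M(2) v(2) pos by (intro sum_mono mult_mono) auto
    finally show ?thesis by simp
  qed
  then have *: "\<bar>diag_ind d a * (M *\<^sub>v v) $ a\<bar> \<le> m * (\<eta> * V)" if "a < d * d" for a
    using that m pos by (auto simp: diag_ind_def)
  have "\<bar>tau d (M *\<^sub>v v)\<bar> \<le> (\<Sum>a<d * d. \<bar>diag_ind d a * (M *\<^sub>v v) $ a\<bar>)"
    unfolding tau_def by (rule sum_abs)
  also have "\<dots> \<le> (\<Sum>a<d * d. m * (\<eta> * V))" using * by (intro sum_mono) auto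
  also have "\<dots> = (d * d) * (m * (\<eta> * V))" by simp
  \<comment> \<open>One factor \<open>m\<close> is the length of a row; the other bounds the number
    \<open>d * d\<close> of coordinates that enter the trace.\<close>
  also have "\<dots> \<le> m * (m * (\<eta> * V))" using m pos by (intro mult_right_mono) (auto simp flip: of_nat_mult)
  finally show ?thesis by (simp add: mult.assoc)
qed

lemma prod_list_map_mult:
  "prod_list (map f xs) * prod_list (map g xs) = prod_list (map (\<lambda>x. f x * g x :: 'a::comm_monoid_mult) xs)"
  by (induction xs) (auto simp: mult_ac)

lemma prod_list_ge:
  fixes xs :: "real list"
  assumes "xs \<noteq> []" "\<forall>x\<in>set xs. x \<ge> L" "L \<ge> 1"
  shows "prod_list xs \<ge> L"
  using assms
proof (induction xs)
  case (Cons x xs)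
  show ?case
  proof (cases "xs = []")
    case False
    with Cons have "prod_list xs \<ge> 1" by simp
    then have "L * 1 \<le> x * prod_list xs" using Cons.prems by (intro mult_mono) auto
    then show ?thesis by simp
  qed (use Cons in auto)
qed simp

lemma abs_entry_le_sqrt_frob2:
  assumes "M \<in> carrier_mat n k" "a < n" "b < k"
  shows "\<bar>M $$ (a,b)\<bar> \<le> sqrt (frob2 M)"
proof -
  have "(M $$ (a,b))\<^sup>2 \<le> (\<Sum>j<k. (M $$ (a,j))\<^sup>2)"
    using assms by (intro member_le_sum) auto
  also have "\<dots> \<le> (\<Sum>i<n. \<Sum>j<k. (M $$ (i,j))\<^sup>2)"
    using assms by (intro member_le_sum[of a "{..<n}" "\<lambda>i. \<Sum>j<k. (M $$ (i,j))\<^sup>2"]) (auto intro: sum_nonneg)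
  finally show ?thesis using assms by (intro real_le_rsqrt) (auto simp: frob2_def)
qed

context
  fixes d m :: nat
  assumes d: "d > 0" and m: "d * d < m"
begin

text \<open>Both claims compare the traces of \<open>v\<close> and \<open>M v\<close> for one
  bounded vector \<open>v\<close>: a large trace of \<open>M v\<close> needs a large entry of
  \<open>M\<close>, and \<open>M\<close> near the identity would leave the trace nearly unchanged.
  The distance \<open>1 / (2 * V)\<close> from the identity is the same for all words, which
  discreteness requires.\<close>

lemma word_estimates:
  assumes ws: "ws \<noteq> []" "successively (\<lambda>x y. fst x \<noteq> fst y) ws"
    and big: "\<forall>x\<in>set ws. snd x \<in> carrier_mat d d \<and> frob2 (snd x) \<ge> 8 * (real d + 2)"
  defines "V \<equiv> real m * real m * (real d + 2)\<^sup>2" and "M \<equiv> fp_eval m (conj_rep d m) (conj_rep' d m) ws"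
  shows "prod_list (map (\<lambda>x. frob2 (snd x) / 2) ws) \<le> V * sqrt (frob2 M)"
    "\<exists>a<m. \<exists>b<m. \<bar>M $$ (a,b) - 1\<^sub>m m $$ (a,b)\<bar> > 1 / (2 * V)"
proof -
  have M: "M \<in> carrier_mat m m"
    unfolding M_def by (induction ws) (auto simp: mult_carrier_mat[of _ m m _ m])
  obtain v where v: "v \<in> carrier_vec m" "\<And>b. b < m \<Longrightarrow> \<bar>v $ b\<bar> \<le> (real d + 2)\<^sup>2" "tau d v \<le> d * (1 + real d)"
    "tau d (M *\<^sub>v v) \<ge> d * prod_list (map (\<lambda>x. frob2 (snd x) / 2) ws)"
    unfolding M_def using tau_word[OF d m ws big] by blast
  have "prod_list (map (\<lambda>x. frob2 (snd x) / 2) ws) \<ge> 4 * (real d + 2)"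
    using ws(1) big by (intro prod_list_ge) auto
  then have P: "prod_list (map (\<lambda>x. frob2 (snd x) / 2) ws) \<ge> 4 * (real d + 2)" (is "?P \<ge> _") .
  have "?P \<le> d * ?P" using P d by (simp add: mult_le_cancel_right1)
  also have "\<dots> \<le> \<bar>tau d (M *\<^sub>v v)\<bar>" using v(4) by simp
  also have "\<dots> \<le> real m * real m * (sqrt (frob2 M) * (real d + 2)\<^sup>2)"
    by (intro abs_tau_mult_le m M v abs_entry_le_sqrt_frob2[OF M])
  finally show "?P \<le> V * sqrt (frob2 M)" by (simp add: V_def mult_ac)
  have V: "V > 0" using m by (auto simp: V_def intro!: mult_pos_pos)
  show "\<exists>a<m. \<exists>b<m. \<bar>M $$ (a,b) - 1\<^sub>m m $$ (a,b)\<bar> > 1 / (2 * V)"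
  proof (rule ccontr)
    assume "\<not> ?thesis"
    then have small: "\<bar>(M - 1\<^sub>m m) $$ (a,b)\<bar> \<le> 1 / (2 * V)" if "a < m" "b < m" for a b
      using that M by fastforce
    have "\<bar>tau d ((M - 1\<^sub>m m) *\<^sub>v v)\<bar> \<le> real m * real m * (1 / (2 * V) * (real d + 2)\<^sup>2)"
      by (intro abs_tau_mult_le m minus_carrier_mat v) (use small in auto)
    also have "\<dots> = 1 / 2" using V m by (simp add: V_def field_simps)
    finally have "\<bar>tau d ((M - 1\<^sub>m m) *\<^sub>v v)\<bar> \<le> 1 / 2" .
    moreover have "tau d ((M - 1\<^sub>m m) *\<^sub>v v) = tau d (M *\<^sub>v v) - tau d v"
    proof -
      have "(M - 1\<^sub>m m) *\<^sub>v v = M *\<^sub>v v - v"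
        using M v(1) by (simp add: minus_mult_distrib_mat_vec[of _ m m])
      then show ?thesis
        using M v(1) m by (simp add: tau_def algebra_simps flip: sum_subtractf)
    qed
    moreover have "d * (4 * (real d + 2)) \<le> tau d (M *\<^sub>v v)"
      using P v(4) mult_left_mono[OF P, of "real d"] by linarith
    \<comment> \<open>The trace of \<open>v\<close> is at most \<open>d * (1 + d)\<close>, while
      even a single letter raises it to \<open>4 * d * (d + 2)\<close>; a change of at most
      \<open>1 / 2\<close> cannot bridge this.\<close>
    moreover have "d * (4 * (real d + 2)) \<ge> d * (1 + real d) + 1"
    proof -
      have "d * (4 * (real d + 2)) - d * (1 + real d) = 3 * (real d * real d) + 7 * real d"
        by (simp add: algebra_simps)
      moreover have "real d * real d \<ge> 0" "real d \<ge> 1" using d by auto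
      ultimately show ?thesis by linarith
    qed
    ultimately show False using v(3) by linarith
  qed
qed

context
  fixes H1 H2 :: "real mat set"
  assumes H: "subgroup H1 (SL d)" "subgroup H2 (SL d)"
    and big: "\<And>g. g \<in> H1 \<union> H2 \<Longrightarrow> g \<noteq> 1\<^sub>m d \<Longrightarrow> frob2 g \<ge> 8 * (real d + 2)"
begin

abbreviation "Ev \<equiv> fp_eval m (conj_rep d m) (conj_rep' d m)"

lemma reduced_word_big:
  assumes "reduced_word d H1 H2 ws"
  shows "successively (\<lambda>x y. fst x \<noteq> fst y) ws"
    "\<forall>x\<in>set ws. snd x \<in> carrier_mat d d \<and> frob2 (snd x) \<ge> 8 * (real d + 2)"
proof -
  show "successively (\<lambda>x y. fst x \<noteq> fst y) ws" using assms by (simp add: reduced_word_iff)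
  show "\<forall>x\<in>set ws. snd x \<in> carrier_mat d d \<and> frob2 (snd x) \<ge> 8 * (real d + 2)"
  proof
    fix x assume x: "x \<in> set ws"
    have "snd x \<in> H1 \<union> H2" "snd x \<noteq> 1\<^sub>m d" using assms x by (auto simp: reduced_word_iff split: if_splits)
    with big show "snd x \<in> carrier_mat d d \<and> frob2 (snd x) \<ge> 8 * (real d + 2)"
      using subgroup_SLD(1)[OF H(1), of "snd x"] subgroup_SLD(1)[OF H(2), of "snd x"] by auto
  qed
qed

text \<open>The quotient of two distinct reduced words is again the image of a nonempty reduced
  word, so the uniform gap at the identity separates any two images after multiplication by the
  inverse of one of them.\<close>

lemma faithful_discrete_conj_rep: "faithful_discrete d m (conj_rep d m) (conj_rep' d m) H1 H2"
proof -
  note rho = conj_rep_hom[OF d m]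
  define V where "V = real m * real m * (real d + 2)\<^sup>2"
  have V: "V > 0" using m by (auto simp: V_def intro!: mult_pos_pos)
  let ?red = "reduced_word d H1 H2"
  have Ec: "Ev ws \<in> carrier_mat m m" for ws
    by (induction ws) (auto simp: mult_carrier_mat[of _ m m _ m])
  have far: "\<exists>a<m. \<exists>b<m. \<bar>(Ev (word_inv ws) * Ev ws') $$ (a,b) - 1\<^sub>m m $$ (a,b)\<bar> > 1 / (2 * V)"
    if red: "?red ws" "?red ws'" "ws \<noteq> ws'" for ws ws'
  proof -
    obtain vs where vs: "vs \<noteq> []" "?red vs" "Ev vs = Ev (word_inv ws) * Ev ws'"
      using word_quotient[OF rho H red] by blast
    show ?thesis
      using word_estimates(2)[OF vs(1) reduced_word_big[OF vs(2)]] unfolding V_def vs(3) .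
  qed
  have inv: "Ev (word_inv ws) * Ev ws = 1\<^sub>m m" if "?red ws" for ws
    by (rule fp_eval_word_inv[OF rho H that])
  have "inj_on Ev {ws. ?red ws}"
  proof (rule inj_onI, rule ccontr)
    fix ws ws' assume *: "ws \<in> {ws. ?red ws}" "ws' \<in> {ws. ?red ws}" "Ev ws = Ev ws'" "ws \<noteq> ws'"
    have "Ev (word_inv ws) * Ev ws' = 1\<^sub>m m" using inv[of ws] * by simp
    with far[of ws ws'] * V show False by auto
  qed
  moreover have "mat_discrete m (Ev ` {ws. ?red ws})"
    unfolding mat_discrete_def
  proof (intro ballI)
    fix x assume "x \<in> Ev ` {ws. ?red ws}"
    then obtain ws where ws: "?red ws" "x = Ev ws" by blast
    define M where "M = Ev (word_inv ws)"
    have M: "M \<in> carrier_mat m m" unfolding M_def by (rule Ec)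
    define B where "B = sqrt (frob2 M)"
    have B: "B \<ge> 0" by (simp add: B_def frob2_nonneg)
    \<comment> \<open>The entries of \<open>M * (y - x)\<close> are at most
      \<open>m * B * e\<close>, which has to stay within the gap \<open>1 / (2 * V)\<close>; the
      summand 1 keeps the denominator positive without a lower bound on \<open>B\<close>.\<close>
    define e where "e = 1 / (2 * V * (m * B + 1))"
    have pos: "m * B + 1 > 0" using B by (simp add: add_nonneg_pos)
    then have e: "e > 0" using V by (simp add: e_def)
    have "(m * B + 1) * e = 1 / (2 * V)" using pos V by (simp add: e_def)
    then have le: "m * (B * e) \<le> 1 / (2 * V)" using e by (simp add: algebra_simps)
    show "\<exists>e>0. \<forall>y\<in>Ev ` {ws. ?red ws}. (\<forall>i<m. \<forall>j<m. \<bar>y $$ (i,j) - x $$ (i,j)\<bar> < e) \<longrightarrow> y = x"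
    proof (intro exI[of _ e] conjI ballI impI e)
      fix y assume "y \<in> Ev ` {ws. ?red ws}" and close: "\<forall>i<m. \<forall>j<m. \<bar>y $$ (i,j) - x $$ (i,j)\<bar> < e"
      then obtain ws' where ws': "?red ws'" "y = Ev ws'" by blast
      show "y = x"
      proof (rule ccontr)
        assume "y \<noteq> x"
        then have "ws \<noteq> ws'" using ws ws' by auto
        then obtain a b where ab: "a < m" "b < m" "\<bar>(M * y) $$ (a,b) - 1\<^sub>m m $$ (a,b)\<bar> > 1 / (2 * V)"
          using far[OF ws(1) ws'(1)] unfolding M_def ws'(2) by blast
        have yx: "y \<in> carrier_mat m m" "x \<in> carrier_mat m m" using Ec ws ws' by auto
        have "M * x = 1\<^sub>m m" using inv[OF ws(1)] by (simp add: M_def ws(2))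
        then have "(M * y) $$ (a,b) - 1\<^sub>m m $$ (a,b) = (M * y) $$ (a,b) - (M * x) $$ (a,b)" by simp
        also have "\<dots> = (\<Sum>k<m. M $$ (a,k) * (y $$ (k,b) - x $$ (k,b)))"
          unfolding mult_entry[OF M yx(1) ab(1,2)] mult_entry[OF M yx(2) ab(1,2)]
          by (simp add: right_diff_distrib sum_subtractf)
        also have "\<bar>\<dots>\<bar> \<le> (\<Sum>k<m. \<bar>M $$ (a,k) * (y $$ (k,b) - x $$ (k,b))\<bar>)" by (rule sum_abs)
        also have "\<dots> \<le> (\<Sum>k<m. B * e)"
          unfolding abs_mult B_def using ab close
          by (intro sum_mono mult_mono abs_entry_le_sqrt_frob2[OF M]) (auto simp: less_imp_le frob2_nonneg)
        also have "\<dots> \<le> 1 / (2 * V)" using le by simp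
        finally show False using ab(3) by simp
      qed
    qed
  qed
  ultimately show ?thesis unfolding faithful_discrete_def by blast
qed

text \<open>Applying the norm bound to the word and to its inverse gives the product of all
  \<open>P x / 4\<close> as a lower bound up to the constant \<open>m * V^2\<close>. Since
  \<open>P x\<close> is at least the square of the singular value ratio of the letter, giving up the
  power \<open>\<epsilon> / 2\<close> of each \<open>P x\<close> leaves the required exponent and
  must pay for the 4 in each letter and once for \<open>m * V^2\<close>.\<close>

lemma sigma_ratio_word_ge:
  assumes ws: "reduced_word d H1 H2 ws" and \<epsilon>: "0 < \<epsilon>" "\<epsilon> < 1"
    and L: "L \<ge> 1" "L \<ge> real m * (real m * real m * (real d + 2)\<^sup>2)\<^sup>2"
    and K: "K \<ge> 1" "K powr \<epsilon> \<ge> 4 * L" "\<And>g. g \<in> H1 \<union> H2 \<Longrightarrow> g \<noteq> 1\<^sub>m d \<Longrightarrow> frob2 g \<ge> K"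
  shows "sigma_ratio 1 m (Ev ws) \<ge> (\<Prod>i<length ws. (sigma_ratio 1 d (snd (ws ! i))) powr (2 - \<epsilon>))"
proof -
  note rho = conj_rep_hom[OF d m]
  define V where "V = real m * real m * (real d + 2)\<^sup>2"
  have mpos: "m > 0" using m by auto
  have V: "V > 0" using m by (auto simp: V_def intro!: mult_pos_pos)
  have Ec: "Ev us \<in> carrier_mat m m" for us
    by (induction us) (auto simp: mult_carrier_mat[of _ m m _ m])
  let ?ws' = "word_inv ws"
  have ws': "reduced_word d H1 H2 ?ws'" by (rule red_word_inv[OF rho H ws])
  have inv: "Ev ?ws' * Ev ws = 1\<^sub>m m" by (rule fp_eval_word_inv[OF rho H ws])
  then have inv': "Ev ws * Ev ?ws' = 1\<^sub>m m" by (rule mat_mult_left_right_inverse[OF Ec Ec])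
  note bounds = sigma_ratio_bounds[OF Ec Ec inv' inv mpos]
  define P where "P x = frob2 (snd x) * frob2 (adj_mat (snd x))" for x :: "bool \<times> real mat"
  have letter: "snd x \<in> carrier (SL d)" "K \<le> frob2 (snd x)" "K \<le> frob2 (adj_mat (snd x))" if x: "x \<in> set ws" for x
  proof -
    show c: "snd x \<in> carrier (SL d)" by (rule red_letters[OF rho H ws x])
    have mem: "snd x \<in> H1 \<union> H2" "snd x \<noteq> 1\<^sub>m d" using ws x by (auto simp: reduced_word_iff split: if_splits)
    then have "adj_mat (snd x) \<in> H1 \<union> H2" using subgroup_SLD(4)[OF H(1)] subgroup_SLD(4)[OF H(2)] by blast
    then show "K \<le> frob2 (snd x)" "K \<le> frob2 (adj_mat (snd x))"
      using K(3) mem adj_mat_ne_one[OF c mem(2)] by auto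
  qed
  have PK: "P x \<ge> K\<^sup>2" if "x \<in> set ws" for x
    unfolding P_def power2_eq_square using letter[OF that] K(1) by (intro mult_mono) auto
  have rhs: "(\<Prod>i<length ws. (sigma_ratio 1 d (snd (ws ! i))) powr (2 - \<epsilon>)) \<le>
      prod_list (map (\<lambda>x. P x powr (1 - \<epsilon> / 2)) ws)"
  proof -
    have "(\<Prod>i<length ws. (sigma_ratio 1 d (snd (ws ! i))) powr (2 - \<epsilon>)) \<le>
        (\<Prod>i<length ws. P (ws ! i) powr (1 - \<epsilon> / 2))"
    proof (intro prod_mono conjI)
      fix i assume "i \<in> {..<length ws}"
      then have x: "ws ! i \<in> set ws" by simp
      define g where "g = snd (ws ! i)"
      have g: "g \<in> carrier (SL d)" using letter(1)[OF x] by (simp add: g_def)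
      note adj = adj_mat_SL[OF g]
      have b: "0 \<le> sigma_ratio 1 d g" "sigma_ratio 1 d g \<le> sqrt (frob2 g * frob2 (adj_mat g))"
        using sigma_ratio_bounds[of g d "adj_mat g"] g adj d by auto
      have "sigma_ratio 1 d g powr (2 - \<epsilon>) \<le> sqrt (frob2 g * frob2 (adj_mat g)) powr (2 - \<epsilon>)"
        using b \<epsilon> by (intro powr_mono2) auto
      also have "\<dots> = P (ws ! i) powr (1 - \<epsilon> / 2)"
        by (simp add: P_def g_def frob2_nonneg powr_powr powr_half_sqrt[symmetric] diff_divide_distrib)
      finally show "sigma_ratio 1 d (snd (ws ! i)) powr (2 - \<epsilon>) \<le> P (ws ! i) powr (1 - \<epsilon> / 2)"
        by (simp add: g_def)
    qed simp
    also have "\<dots> = prod_list (map (\<lambda>x. P x powr (1 - \<epsilon> / 2)) ws)"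
      by (simp add: prod.list_conv_set_nth atLeast0LessThan)
    finally show ?thesis .
  qed
  show ?thesis
  proof (cases "ws = []")
    case True
    \<comment> \<open>With no letter available to absorb a constant, the empty word relies on the
      exact value: the lower bound \<open>sqrt (m * m) / m\<close> equals 1.\<close>
    have "frob2 (1\<^sub>m m) = (\<Sum>i<m. \<Sum>j<m. if i = j then 1 else 0)"
      unfolding frob2_def by (intro sum.cong) auto
    then have "frob2 (1\<^sub>m m) = m" by simp
    then show ?thesis using bounds(1) True mpos by (simp add: word_inv_def)
  next
    case False
    then have False': "?ws' \<noteq> []" by (simp add: word_inv_def)
    let ?Q = "\<lambda>us. prod_list (map (\<lambda>x. frob2 (snd x) / 2) us)"
    note est = word_estimates(1)[OF False reduced_word_big[OF ws], folded V_def]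
    note est' = word_estimates(1)[OF False' reduced_word_big[OF ws'], folded V_def]
    have nonneg: "0 \<le> ?Q us" for us by (induction us) (auto simp: frob2_nonneg)
    have "?Q ws * ?Q ?ws' = prod_list (map (\<lambda>x. P x / 4) ws)"
    proof -
      have "?Q ?ws' = prod_list (map (\<lambda>x. frob2 (adj_mat (snd x)) / 2) ws)"
        by (simp add: word_inv_def prod_list.rev o_def flip: rev_map)
      then show ?thesis by (simp add: P_def prod_list_map_mult)
    qed
    moreover have "?Q ws * ?Q ?ws' \<le> (V * sqrt (frob2 (Ev ws))) * (V * sqrt (frob2 (Ev ?ws')))"
      using est est' nonneg by (intro mult_mono) (auto intro: order_trans)
    moreover have "\<dots> = V\<^sup>2 * sqrt (frob2 (Ev ws) * frob2 (Ev ?ws'))"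
      by (simp add: real_sqrt_mult power2_eq_square)
    moreover have "\<dots> \<le> V\<^sup>2 * (m * sigma_ratio 1 m (Ev ws))"
      using bounds(1) mpos by (intro mult_left_mono) (auto simp: field_simps)
    ultimately have low: "prod_list (map (\<lambda>x. P x / 4) ws) \<le> (m * V\<^sup>2) * sigma_ratio 1 m (Ev ws)"
      by (simp add: mult_ac)
    have split: "prod_list (map (\<lambda>x. P x / 4) ws) =
        prod_list (map (\<lambda>x. P x powr (\<epsilon> / 2) / 4) ws) * prod_list (map (\<lambda>x. P x powr (1 - \<epsilon> / 2)) ws)"
    proof -
      have "P x / 4 = P x powr (\<epsilon> / 2) / 4 * P x powr (1 - \<epsilon> / 2)" if "x \<in> set ws" for x
      proof -
        have "P x > 0" using PK[OF that] zero_less_power[of K 2] K(1) by linarith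
        then have "P x powr (\<epsilon> / 2) * P x powr (1 - \<epsilon> / 2) = P x" by (simp flip: powr_add)
        then show ?thesis by simp
      qed
      then show ?thesis unfolding prod_list_map_mult by (intro arg_cong[of _ _ prod_list] map_cong) auto
    qed
    have "prod_list (map (\<lambda>x. P x powr (\<epsilon> / 2) / 4) ws) \<ge> L"
    proof (rule prod_list_ge)
      have "L \<le> P x powr (\<epsilon> / 2) / 4" if x: "x \<in> set ws" for x
      proof -
        \<comment> \<open>A letter and its inverse both have squared norm at least \<open>K\<close>,
          so \<open>P x\<close> is at least \<open>K^2\<close>; this is why the assumption on
          \<open>K\<close> carries the exponent \<open>\<epsilon>\<close> rather than
          \<open>\<epsilon> / 2\<close>.\<close>
        have "K powr \<epsilon> = (K\<^sup>2) powr (\<epsilon> / 2)" using K(1) by (simp add: powr_powr flip: powr_numeral)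
        also have "\<dots> \<le> P x powr (\<epsilon> / 2)" using PK[OF x] \<epsilon> K(1) by (intro powr_mono2) auto
        finally show ?thesis using K(2) by simp
      qed
      then show "\<forall>y\<in>set (map (\<lambda>x. P x powr (\<epsilon> / 2) / 4) ws). L \<le> y" by auto
    qed (use False L in auto)
    then have "L * prod_list (map (\<lambda>x. P x powr (1 - \<epsilon> / 2)) ws) \<le> prod_list (map (\<lambda>x. P x / 4) ws)"
      unfolding split by (intro mult_right_mono) (auto intro!: prod_list_nonneg)
    also have "\<dots> \<le> (m * V\<^sup>2) * sigma_ratio 1 m (Ev ws)" by (rule low)
    also have "\<dots> \<le> L * sigma_ratio 1 m (Ev ws)"
      using L(2) bounds(3) by (intro mult_right_mono) (auto simp: V_def)
    finally have "prod_list (map (\<lambda>x. P x powr (1 - \<epsilon> / 2)) ws) \<le> sigma_ratio 1 m (Ev ws)"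
      using L(1) by simp
    with rhs show ?thesis by linarith
  qed
qed

end

end

section \<open>Choice of the subgroups and of the constants\<close>

lemma finite_index_large:
  assumes "discrete_fg_subgroup d \<Gamma>"
  obtains H where "finite_index_sub d H \<Gamma>" "\<And>g. g \<in> H \<Longrightarrow> g \<noteq> 1\<^sub>m d \<Longrightarrow> frob2 g \<ge> K"
proof -
  from assms obtain S where \<Gamma>: "subgroup \<Gamma> (SL d)" "mat_discrete d \<Gamma>"
    and S: "finite S" "S \<subseteq> carrier (SL d)" "generate (SL d) S = \<Gamma>"
    unfolding discrete_fg_subgroup_def by blast
  define F where "F = {g \<in> \<Gamma>. frob2 g < K} - {1\<^sub>m d}"
  have "F \<subseteq> {g \<in> \<Gamma>. \<forall>i<d. \<forall>j<d. \<bar>g $$ (i,j)\<bar> \<le> sqrt K}"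
  proof (clarsimp simp: F_def)
    fix g i j assume g: "g \<in> \<Gamma>" "frob2 g < K" and ij: "i < d" "j < d"
    have "\<bar>g $$ (i,j)\<bar> \<le> sqrt (frob2 g)"
      using subgroup_SLD(1)[OF \<Gamma>(1) g(1)] ij by (intro abs_entry_le_sqrt_frob2) auto
    also have "\<dots> \<le> sqrt K" using g by simp
    finally show "\<bar>g $$ (i,j)\<bar> \<le> sqrt K" .
  qed
  then have "finite F" by (rule finite_subset) (rule finite_bounded_of_discrete[OF \<Gamma>])
  moreover have "1\<^sub>m d \<notin> F" by (simp add: F_def)
  ultimately obtain H where H: "finite_index_sub d H \<Gamma>" "H \<inter> F = {}"
    by (rule finite_index_avoiding[OF \<Gamma>(1) S])
  have "frob2 g \<ge> K" if "g \<in> H" "g \<noteq> 1\<^sub>m d" for g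
    using H that by (force simp: F_def finite_index_sub_def)
  with H(1) show ?thesis by (rule that)
qed

theorem theorem1p6:
  fixes d :: nat
  assumes "d \<ge> 2"
  shows "\<exists>rho1 rho2.
    rho1 \<in> hom (SL d) (GL (d^2 * (d+1)^2 div 4 + 1)) \<and>
    rho2 \<in> hom (SL d) (GL (d^2 * (d+1)^2 div 4 + 1)) \<and>
    (\<forall>\<Gamma>1 \<Gamma>2. discrete_fg_subgroup d \<Gamma>1 \<and> discrete_fg_subgroup d \<Gamma>2 \<longrightarrow>
       (\<exists>H1 H2. finite_index_sub d H1 \<Gamma>1 \<and> finite_index_sub d H2 \<Gamma>2 \<and>
          faithful_discrete d (d^2 * (d+1)^2 div 4 + 1) rho1 rho2 H1 H2) \<and>
       (\<forall>\<epsilon>::real. 0 < \<epsilon> \<and> \<epsilon> < 1 \<longrightarrow>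
          (\<exists>H1 H2. finite_index_sub d H1 \<Gamma>1 \<and> finite_index_sub d H2 \<Gamma>2 \<and>
             faithful_discrete d (d^2 * (d+1)^2 div 4 + 1) rho1 rho2 H1 H2 \<and>
             (\<forall>ws. reduced_word d H1 H2 ws \<longrightarrow>
                sigma_ratio 1 (d^2 * (d+1)^2 div 4 + 1)
                  (fp_eval (d^2 * (d+1)^2 div 4 + 1) rho1 rho2 ws)
                \<ge> (\<Prod>i<length ws. (sigma_ratio 1 d (snd (ws ! i))) powr (2 - \<epsilon>))))))"
proof -
  define m where "m = d^2 * (d+1)^2 div 4 + 1"
  have d: "d > 0" using assms by simp
  have m: "d * d < m"
  proof -
    have "2 ^ 2 \<le> (d + 1)^2" using assms by (intro power_mono) auto
    then have "d^2 * 4 \<le> d^2 * (d + 1)^2" by (intro mult_left_mono) auto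
    then have "d^2 * 4 div 4 \<le> d^2 * (d + 1)^2 div 4" by (rule div_le_mono)
    then show ?thesis by (simp add: m_def power2_eq_square)
  qed
  let ?R = "conj_rep d m" and ?S = "conj_rep' d m"
  have main: "\<exists>H1 H2. finite_index_sub d H1 \<Gamma>1 \<and> finite_index_sub d H2 \<Gamma>2 \<and>
      faithful_discrete d m ?R ?S H1 H2 \<and>
      (\<forall>ws. reduced_word d H1 H2 ws \<longrightarrow> sigma_ratio 1 m (fp_eval m ?R ?S ws)
          \<ge> (\<Prod>i<length ws. (sigma_ratio 1 d (snd (ws ! i))) powr (2 - \<epsilon>)))"
    if \<Gamma>: "discrete_fg_subgroup d \<Gamma>1" "discrete_fg_subgroup d \<Gamma>2" and \<epsilon>: "0 < \<epsilon>" "\<epsilon> < 1"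
    for \<Gamma>1 \<Gamma>2 and \<epsilon> :: real
  proof -
    define L where "L = max 1 (real m * (real m * real m * (real d + 2)\<^sup>2)\<^sup>2)"
    \<comment> \<open>The first value is the ping-pong threshold, the second makes
      \<open>K powr \<epsilon>\<close> at least \<open>4 * L\<close>. Only this bound, and hence the
      subgroups, depends on \<open>\<epsilon>\<close>; the representation does not.\<close>
    define K where "K = max (8 * (real d + 2)) ((4 * L) powr (1 / \<epsilon>))"
    have L: "L \<ge> 1" "L \<ge> real m * (real m * real m * (real d + 2)\<^sup>2)\<^sup>2" by (auto simp: L_def)
    have K1: "K \<ge> 1" "K \<ge> 8 * (real d + 2)" by (auto simp: K_def max_def)
    have "4 * L = ((4 * L) powr (1 / \<epsilon>)) powr \<epsilon>" using L \<epsilon> by (simp add: powr_powr)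
    also have "\<dots> \<le> K powr \<epsilon>" using \<epsilon> by (intro powr_mono2) (auto simp: K_def)
    finally have K2: "K powr \<epsilon> \<ge> 4 * L" .
    obtain H1 where H1: "finite_index_sub d H1 \<Gamma>1" "\<And>g. g \<in> H1 \<Longrightarrow> g \<noteq> 1\<^sub>m d \<Longrightarrow> frob2 g \<ge> K"
      using finite_index_large[OF \<Gamma>(1)] by blast
    obtain H2 where H2: "finite_index_sub d H2 \<Gamma>2" "\<And>g. g \<in> H2 \<Longrightarrow> g \<noteq> 1\<^sub>m d \<Longrightarrow> frob2 g \<ge> K"
      using finite_index_large[OF \<Gamma>(2)] by blast
    have sub: "subgroup H1 (SL d)" "subgroup H2 (SL d)" using H1(1) H2(1) by (auto simp: finite_index_sub_def)
    have bigK: "frob2 g \<ge> K" if "g \<in> H1 \<union> H2" "g \<noteq> 1\<^sub>m d" for g using that H1(2) H2(2) by blast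
    then have big: "frob2 g \<ge> 8 * (real d + 2)" if "g \<in> H1 \<union> H2" "g \<noteq> 1\<^sub>m d" for g
      using that K1(2) by force
    show ?thesis
      using H1(1) H2(1) faithful_discrete_conj_rep[OF d m sub big]
        sigma_ratio_word_ge[OF d m sub big _ \<epsilon> L K1(1) K2 bigK] by blast
  qed
  \<comment> \<open>The claim without singular values has no \<open>\<epsilon>\<close>; it is
    obtained from the quantitative one at \<open>\<epsilon> = 1 / 2\<close>.\<close>
  have half: "(0::real) < 1 / 2" "(1::real) / 2 < 1" by auto
  show ?thesis
    unfolding m_def[symmetric]
  proof (rule exI[of _ ?R], rule exI[of _ ?S], intro conjI allI impI)
    fix \<Gamma>1 \<Gamma>2 assume \<Gamma>: "discrete_fg_subgroup d \<Gamma>1 \<and> discrete_fg_subgroup d \<Gamma>2"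
    show "\<exists>H1 H2. finite_index_sub d H1 \<Gamma>1 \<and> finite_index_sub d H2 \<Gamma>2 \<and> faithful_discrete d m ?R ?S H1 H2"
      using main[OF conjunct1[OF \<Gamma>] conjunct2[OF \<Gamma>] half] by blast
  qed (use conj_rep_hom[OF d m] main in auto)
qed

end
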